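(* Let $(\Omega,d)$ be a Polish metric space, let $(X_t)_{t\ge 0}$ be a time-inhomogeneous Markov chain on $\Omega$ with initial distribution $\mu_0$ and Markov kernels $(P_t)_{t\ge 1}$, and let $F_t:\Omega\to \mathsf{H}_m$, $t\ge 1$. Assume: (1) $D:=\sup_{x,y\in\Omega}d(x,y)<\infty$; (2) there exists $L>0$ such that $\mathrm{Lip}(F_t)^{\mathrm{op}}\le L$ for all $t$; (3) there exists $\kappa>0$ such that the curvature $\kappa_t$ of $P_t$ satisfies $\kappa_t\ge\kappa$ for all $t\ge1$. Let $\Delta_{\mathrm{op}}:=\sup_t \sup_{x,y\in\Omega}\|F_t(x)-F_t(y)\|_{\mathrm{op}}\in(0,LD]$ and $$\overline v^2:=\frac{3200}{\pi^2}\,\Delta_{\mathrm{op}}^2\,\kappa^{-1}\left(1+\log\frac{LD}{\Delta_{\mathrm{op}}}\right).$$ Then for every integer $n\ge 1$ and every $\varepsilon>0$, $$\mathbb{P}_{\mu_0}\Big(\lambda_{\max}\Big(\sum_{j=1}^n (F_j(X_j)-\mathbb{E}F_j(X_j))\Big)\ge n\varepsilon\Big)\le m^{2-\pi/4}\exp\left(-\frac{n\varepsilon^2}{2\overline v^2}\right).$$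
   Context: $\mathsf{H}_m$ is the set of $m\times m$ complex Hermitian matrices, $\lambda_{\max}$ the largest eigenvalue, $\|\cdot\|_{\mathrm{op}}$ the operator norm. A time-inhomogeneous Markov chain with kernels $P_t$ satisfies $\mathbb{P}(X_t\in A\mid X_{t-1}=x)=P_t(x,A)$ for $t\ge1$; $\mathbb{P}_{\mu_0}$ and $\mathbb{E}$ refer to the path law with $X_0\sim\mu_0$. Operator Lipschitz seminorm: for $F:\Omega\to\mathbb{C}^{m\times m}$, $\mathrm{Lip}(F)^{\mathrm{op}}:=\sup_{x\ne y}\|F(x)-F(y)\|_{\mathrm{op}}/d(x,y)$. Curvature at time $t$: $\kappa_t:=\inf_{x\ne y}\Big(1-\frac{W_1(P_t(x,\cdot),P_t(y,\cdot))}{d(x,y)}\Big)$, where $W_1$ is the Wasserstein-1 distance $W_1(\mu,\nu)=\inf_{\pi\in\Pi(\mu,\nu)}\int d(x,y)\,d\pi(x,y)$ and $\Pi(\mu,\nu)$ is the set of couplings of $\mu$ and $\nu$. *)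

theory Defs
  imports "HOL-Probability.Probability"
begin

section \<open>Hermitian matrices\<close>

definition hermitian :: "complex ^ 'm ^ 'm \<Rightarrow> bool" where
  "hermitian A \<longleftrightarrow> (\<forall>i j. A $ i $ j = cnj (A $ j $ i))"

text \<open>Only real eigenvalues are collected. For Hermitian \<open>A\<close> these are all the eigenvalues, and
  the set is finite and nonempty, so that \<open>Max\<close> is meaningful.\<close>

definition lambda_max :: "complex ^ 'm ^ 'm \<Rightarrow> real" where
  "lambda_max A = Max {l. \<exists>v. v \<noteq> 0 \<and> A *v v = complex_of_real l *s v}"

text \<open>The norm on \<^typ>\<open>complex ^ 'm\<close> is the Euclidean one, so this is the spectral norm.\<close>

definition op_norm :: "complex ^ 'm ^ 'm \<Rightarrow> real" where
  "op_norm A = onorm ((*v) A)"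

section \<open>Lipschitz seminorm and oscillation\<close>

definition Lip_op :: "('a::metric_space \<Rightarrow> complex ^ 'm ^ 'm) \<Rightarrow> ennreal" where
  "Lip_op F = (SUP (x, y)\<in>{(x, y). x \<noteq> y}. ennreal (op_norm (F x - F y) / dist x y))"

definition Delta_op :: "(nat \<Rightarrow> 'a \<Rightarrow> complex ^ 'm ^ 'm) \<Rightarrow> ennreal" where
  "Delta_op F = (SUP t\<in>{1..}. SUP x. SUP y. ennreal (op_norm (F t x - F t y)))"

section \<open>Wasserstein distance and curvature\<close>

text \<open>The second argument of \<^const>\<open>distr\<close> only provides the sigma-algebra.\<close>

definition couplings :: "'a measure \<Rightarrow> 'a measure \<Rightarrow> ('a \<times> 'a) measure set" where
  "couplings \<mu> \<nu> = {\<pi>. sets \<pi> = sets (\<mu> \<Otimes>\<^sub>M \<nu>) \<and> distr \<pi> \<mu> fst = \<mu> \<and> distr \<pi> \<nu> snd = \<nu>}"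

definition W1 :: "'a::metric_space measure \<Rightarrow> 'a measure \<Rightarrow> ennreal" where
  "W1 \<mu> \<nu> = (INF \<pi>\<in>couplings \<mu> \<nu>. \<integral>\<^sup>+ z. ennreal (dist (fst z) (snd z)) \<partial>\<pi>)"

definition curvature :: "('a::metric_space \<Rightarrow> 'a measure) \<Rightarrow> ereal" where
  "curvature K = (INF (x, y)\<in>{(x, y). x \<noteq> y}. 1 - enn2ereal (W1 (K x) (K y)) / ereal (dist x y))"

section \<open>Time-inhomogeneous Markov chains\<close>

definition past :: "'w measure \<Rightarrow> (nat \<Rightarrow> 'w \<Rightarrow> 'a::topological_space) \<Rightarrow> nat \<Rightarrow> 'w measure" where
  "past M X t = sigma (space M) {X s -` A \<inter> space M | s A. s < t \<and> A \<in> sets borel}"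

text \<open>The kernels are indexed by \<open>t \<ge> 1\<close>; \<open>P 0\<close> is irrelevant. The last assumption says
  \<open>Prob(X\<^sub>t \<in> A | X\<^sub>0, \<dots>, X\<^sub>t\<^sub>-\<^sub>1) = P\<^sub>t(X\<^sub>t\<^sub>-\<^sub>1, A)\<close> almost surely.\<close>

locale markov_chain = prob_space M
  for M :: "'w measure" +
  fixes \<mu>0 :: "'a::polish_space measure"
    and P :: "nat \<Rightarrow> 'a \<Rightarrow> 'a measure"
    and X :: "nat \<Rightarrow> 'w \<Rightarrow> 'a"
  assumes X_measurable: "X t \<in> M \<rightarrow>\<^sub>M borel"
    and initial: "distr M borel (X 0) = \<mu>0"
    and kernel: "t \<ge> 1 \<Longrightarrow> P t \<in> borel \<rightarrow>\<^sub>M prob_algebra borel"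
    and markov: "t \<ge> 1 \<Longrightarrow> A \<in> sets borel \<Longrightarrow>
      AE \<omega> in M. real_cond_exp M (past M X t) (\<lambda>\<omega>. indicator A (X t \<omega>)) \<omega>
        = measure (P t (X (t - 1) \<omega>)) A"

end

theory Submission
  imports Defs
begin

text \<open>
  The centred sum is treated as the end point of a matrix martingale with bounded increments, so that
  the tail bound is a Hermitian Azuma inequality (\<open>lambda_max_tail\<close>). Two ideas are involved.

  The first is to reveal the chain in blocks. Revealing the states one at a time gives increments of
  size about \<open>\<Delta> K\<close> with \<open>K = (1 + ln (L D / \<Delta>)) / \<kappa>\<close>, hence a variance proxy quadratic in \<open>K\<close>. Revealing a
  whole block of length \<open>l\<close>, about \<open>K\<close>, costs essentially no more per increment: curvature \<open>\<kappa>\<close> makes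
  every kernel contract Lipschitz constants by \<open>1 - \<kappa>\<close> (\<open>kernel_contraction\<close>, \<open>pull_lipschitz\<close>), so the
  influence of a block on the conditional means fades within about one further block, and an
  increment is at most \<open>3 l \<Delta>\<close> (\<open>block_increment_bound\<close>). With about \<open>n / l\<close> blocks the sum of the
  squared increments is of order \<open>n l \<Delta>\<^sup>2\<close>, which is linear in \<open>K\<close>. It is at most \<open>36 n K \<Delta>\<^sup>2\<close>, and
  \<open>3200 / pi\<^sup>2\<close> is larger than \<open>36\<close>.

  The second concerns Azuma's inequality for matrices. Since the increments are bounded by multiples of
  the identity, no inequality for traces of matrix exponentials is needed. The potential is the trace of
  a high even power of \<open>1 + \<theta> W / p\<close>. Along a Hermitian perturbation \<open>A + t D\<close> its second derivative is a
  sum of traces of words \<open>A\<^sup>i D A\<^sup>j D\<close>, and convexity in \<open>i\<close> bounds each word by the extreme one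
  (\<open>inner_sandwich_le\<close>). A comparison with the hyperbolic cosine then shows that a step multiplies the
  expected potential by at most \<open>cosh (\<theta> C)\<close>, up to a term that vanishes as \<open>p\<close> grows
  (\<open>trpow_perturbation\<close>, \<open>trpow_moment_bound\<close>). Letting \<open>p\<close> tend to infinity yields the prefactor \<open>m\<close>,
  which is at most \<open>m powr (2 - pi / 4)\<close>.
\<close>

section \<open>Powers of Hermitian matrices and the Frobenius inner product\<close>

lemma bounded_bilinear_matrix_mult:
  "bounded_bilinear ((**) :: complex^'m^'m \<Rightarrow> complex^'m^'m \<Rightarrow> complex^'m^'m)"
  unfolding bilinear_conv_bounded_bilinear[symmetric] bilinear_def
  by (auto intro!: linearI simp: matrix_matrix_mult_def vec_eq_iff sum.distrib ring_distribs
      scaleR_sum_right)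

interpretation mmul: bounded_bilinear "(**) :: complex^'m^'m \<Rightarrow> complex^'m^'m \<Rightarrow> complex^'m^'m"
  by (rule bounded_bilinear_matrix_mult)

lemma bounded_bilinear_matrix_vector:
  "bounded_bilinear ((*v) :: complex^'m^'m \<Rightarrow> complex^'m \<Rightarrow> complex^'m)"
  unfolding bilinear_conv_bounded_bilinear[symmetric] bilinear_def
  by (auto intro!: linearI simp: matrix_vector_mult_def vec_eq_iff sum.distrib ring_distribs
      scaleR_sum_right)

interpretation mvec: bounded_bilinear "(*v) :: complex^'m^'m \<Rightarrow> complex^'m \<Rightarrow> complex^'m"
  by (rule bounded_bilinear_matrix_vector)

lemma inner_complex_mult_left: "inner (a * x) y = inner x (cnj a * y)" for a x y :: complex
  by (simp add: inner_complex_def algebra_simps)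

lemma inner_complex_mult_right: "inner (x * a) y = inner x (y * cnj a)" for a x y :: complex
  by (simp add: inner_complex_def algebra_simps)

lemma hermitian_cnj: "hermitian A \<Longrightarrow> cnj (A $ i $ j) = A $ j $ i"
  unfolding hermitian_def by (metis complex_cnj_cnj)

text \<open>The real inner product on \<^typ>\<open>complex^'m^'m\<close> is \<open>Re (tr (X\<^sup>* Y))\<close>. A Hermitian factor can
  therefore be moved across it on either side; this and the Cauchy--Schwarz inequality are all
  that the trace inequalities below use.\<close>

lemma inner_hermitian_left:
  assumes "hermitian A"
  shows "inner (A ** X) Y = inner X (A ** Y)"
proof -
  have "inner (A ** X) Y = (\<Sum>i\<in>UNIV. \<Sum>j\<in>UNIV. \<Sum>k\<in>UNIV. inner (X$k$j) (A$k$i * Y$i$j))"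
    by (simp add: inner_vec_def matrix_matrix_mult_def inner_sum_left inner_complex_mult_left
        hermitian_cnj[OF assms])
  also have "\<dots> = (\<Sum>i\<in>UNIV. \<Sum>k\<in>UNIV. \<Sum>j\<in>UNIV. inner (X$k$j) (A$k$i * Y$i$j))"
    by (intro sum.cong refl sum.swap)
  also have "\<dots> = (\<Sum>k\<in>UNIV. \<Sum>i\<in>UNIV. \<Sum>j\<in>UNIV. inner (X$k$j) (A$k$i * Y$i$j))"
    by (rule sum.swap)
  also have "\<dots> = (\<Sum>k\<in>UNIV. \<Sum>j\<in>UNIV. \<Sum>i\<in>UNIV. inner (X$k$j) (A$k$i * Y$i$j))"
    by (intro sum.cong refl sum.swap)
  finally show ?thesis
    by (simp add: inner_vec_def matrix_matrix_mult_def inner_sum_right)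
qed

lemma inner_hermitian_right:
  assumes "hermitian A"
  shows "inner (X ** A) Y = inner X (Y ** A)"
proof -
  have "inner (X ** A) Y = (\<Sum>i\<in>UNIV. \<Sum>j\<in>UNIV. \<Sum>k\<in>UNIV. inner (X$i$k) (Y$i$j * A$j$k))"
    by (simp add: inner_vec_def matrix_matrix_mult_def inner_sum_left inner_complex_mult_right
        hermitian_cnj[OF assms])
  also have "\<dots> = (\<Sum>i\<in>UNIV. \<Sum>k\<in>UNIV. \<Sum>j\<in>UNIV. inner (X$i$k) (Y$i$j * A$j$k))"
    by (intro sum.cong refl sum.swap)
  finally show ?thesis
    by (simp add: inner_vec_def matrix_matrix_mult_def inner_sum_right)
qed

lemma inner_hermitian_vec:
  assumes "hermitian A"
  shows "inner (A *v x) y = inner x (A *v y)"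
proof -
  have "inner (A *v x) y = (\<Sum>i\<in>UNIV. \<Sum>k\<in>UNIV. inner (x$k) (A$k$i * y$i))"
    by (simp add: inner_vec_def matrix_vector_mult_def inner_sum_left inner_complex_mult_left
        hermitian_cnj[OF assms])
  also have "\<dots> = (\<Sum>k\<in>UNIV. \<Sum>i\<in>UNIV. inner (x$k) (A$k$i * y$i))"
    by (rule sum.swap)
  finally show ?thesis
    by (simp add: inner_vec_def matrix_vector_mult_def inner_sum_right)
qed

lemma hermitianI: "(\<And>i j. cnj (A $ i $ j) = A $ j $ i) \<Longrightarrow> hermitian A"
  unfolding hermitian_def by simp

lemma hermitian_add: "hermitian A \<Longrightarrow> hermitian B \<Longrightarrow> hermitian (A + B)"
  and hermitian_diff: "hermitian A \<Longrightarrow> hermitian B \<Longrightarrow> hermitian (A - B)"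
  and hermitian_scaleR: "hermitian A \<Longrightarrow> hermitian (r *\<^sub>R A)"
  by (auto intro!: hermitianI simp: hermitian_cnj)

lemma hermitian_0: "hermitian 0"
  by (auto intro!: hermitianI)

lemma hermitian_sum: "(\<And>i. i \<in> I \<Longrightarrow> hermitian (A i)) \<Longrightarrow> hermitian (sum A I)"
  by (induction I rule: infinite_finite_induct) (auto simp: hermitian_add hermitian_0)

lemma hermitian_mat1: "hermitian (mat 1)"
  by (auto intro!: hermitianI simp: mat_def)

primrec mpow :: "complex^'m^'m \<Rightarrow> nat \<Rightarrow> complex^'m^'m" where
  "mpow A 0 = mat 1"
| "mpow A (Suc k) = A ** mpow A k"

lemma mpow_add: "mpow A (i + j) = mpow A i ** mpow A j"
  by (induction i) (auto simp: matrix_mul_assoc)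

lemma mpow_Suc_right: "mpow A (Suc k) = mpow A k ** A"
  using mpow_add[of A k 1] by simp

lemma inner_mpow_left:
  "hermitian A \<Longrightarrow> inner (mpow A k ** X) Y = inner X (mpow A k ** Y)"
proof (induction k arbitrary: X Y)
  case (Suc k)
  have "inner (mpow A (Suc k) ** X) Y = inner (A ** (mpow A k ** X)) Y"
    by (simp add: matrix_mul_assoc)
  also have "\<dots> = inner X (mpow A k ** (A ** Y))"
    using Suc by (simp add: inner_hermitian_left)
  finally show ?case by (simp only: matrix_mul_assoc mpow_Suc_right)
qed simp

lemma inner_mpow_right:
  "hermitian A \<Longrightarrow> inner (X ** mpow A k) Y = inner X (Y ** mpow A k)"
proof (induction k arbitrary: X Y)
  case (Suc k)
  have "inner (X ** mpow A (Suc k)) Y = inner ((X ** mpow A k) ** A) Y"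
    by (simp only: matrix_mul_assoc mpow_Suc_right)
  also have "\<dots> = inner X ((Y ** A) ** mpow A k)"
    using Suc by (simp add: inner_hermitian_right)
  finally show ?case by (simp add: matrix_mul_assoc)
qed simp

text \<open>These words arise when a power of \<open>A + t D\<close> is differentiated in \<open>t\<close>.\<close>

definition sandwich :: "complex^'m^'m \<Rightarrow> complex^'m^'m \<Rightarrow> nat \<Rightarrow> nat \<Rightarrow> complex^'m^'m" where
  "sandwich A D i j = mpow A i ** D ** mpow A j"

lemma inner_sandwich:
  assumes "hermitian A"
  shows "inner (sandwich A D i j) (sandwich A D i' j') = inner (sandwich A D (i + i') (j + j')) D"
proof -
  have "inner (sandwich A D (i + i') (j + j')) D
      = inner (mpow A i' ** (mpow A i ** D ** mpow A j) ** mpow A j') D"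
    unfolding sandwich_def add.commute[of i] by (simp add: mpow_add matrix_mul_assoc)
  also have "\<dots> = inner (mpow A i' ** (mpow A i ** D ** mpow A j)) (D ** mpow A j')"
    by (rule inner_mpow_right[OF assms])
  also have "\<dots> = inner (mpow A i ** D ** mpow A j) (mpow A i' ** (D ** mpow A j'))"
    by (rule inner_mpow_left[OF assms])
  finally show ?thesis by (simp add: sandwich_def matrix_mul_assoc)
qed

text \<open>A discretely convex sequence lies below the chord through its endpoints.\<close>

lemma discrete_convex_chord:
  fixes u :: "nat \<Rightarrow> real"
  assumes conv: "\<And>a. 0 < a \<Longrightarrow> a < q \<Longrightarrow> 2 * u a \<le> u (a - 1) + u (a + 1)" and "a \<le> q" "0 < q"
  shows "real q * u a \<le> real (q - a) * u 0 + real a * u q"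
proof -
  have step: "a < q \<Longrightarrow> real (a + 1) * u a \<le> real a * u (a + 1) + u 0" for a
  proof (induction a)
    case (Suc a)
    have "2 * u (Suc a) \<le> u a + u (a + 2)" using conv[of "Suc a"] Suc.prems by simp
    then have "real (a + 1) * (2 * u (Suc a)) \<le> real (a + 1) * (u a + u (a + 2))"
      by (intro mult_left_mono) auto
    with Suc show ?case by (simp add: algebra_simps)
  qed simp
  have "r \<le> q \<Longrightarrow> a \<le> r \<Longrightarrow> real r * u a \<le> real (r - a) * u 0 + real a * u r" for r
  proof (induction r)
    case (Suc r)
    show ?case
    proof (cases "a = Suc r")
      case False
      then have "a \<le> r" using Suc.prems by simp
      then have IH: "real r * u a \<le> real (r - a) * u 0 + real a * u r" using Suc by simp
      show ?thesis
      proof (cases "r = 0")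
        case True
        then show ?thesis using \<open>a \<le> r\<close> by simp
      next
        case r0: False
        have "real r * (real (r + 1) * u a) \<le> real (r + 1) * (real (r - a) * u 0 + real a * u r)"
          using mult_left_mono[OF IH, of "real (r + 1)"] by (simp add: algebra_simps)
        also have "\<dots> \<le> real (r + 1) * (real (r - a) * u 0) + real a * (real r * u (r + 1) + u 0)"
          using mult_left_mono[OF step[of r], of "real a"] Suc.prems by (simp add: algebra_simps)
        also have "\<dots> = real r * (real (Suc r - a) * u 0 + real a * u (Suc r))"
          using \<open>a \<le> r\<close> by (simp add: of_nat_diff algebra_simps)
        finally show ?thesis using r0 by simp
      qed
    qed simp
  qed simp
  from this[of q] assms show ?thesis by simp
qed

lemma norm_matrix_mult_le:
  fixes D X :: "complex^'m^'m"
  assumes "\<And>v. norm (D *v v) \<le> c * norm v"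
  shows "(norm (D ** X))\<^sup>2 \<le> c\<^sup>2 * (norm X)\<^sup>2"
proof -
  have col: "(norm Y)\<^sup>2 = (\<Sum>j\<in>UNIV. (norm (column j Y))\<^sup>2)" for Y :: "complex^'m^'m"
    by (simp only: power2_norm_eq_inner inner_vec_def column_def vec_lambda_beta) (rule sum.swap)
  have "column j (D ** X) = D *v column j X" for j
    by (simp add: vec_eq_iff column_def matrix_matrix_mult_def matrix_vector_mult_def)
  then have "(norm (D ** X))\<^sup>2 = (\<Sum>j\<in>UNIV. (norm (D *v column j X))\<^sup>2)"
    by (simp add: col[of "D ** X"])
  also have "\<dots> \<le> (\<Sum>j\<in>UNIV. (c * norm (column j X))\<^sup>2)"
    by (intro sum_mono power_mono assms) auto
  finally show ?thesis by (simp add: col[of X] sum_distrib_left power_mult_distrib)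
qed

text \<open>Cauchy--Schwarz makes \<open>u a = \<parallel>A\<^sup>a D A\<^sup>q\<^sup>-\<^sup>a\<parallel>\<^sup>2\<close> a discretely convex sequence that is symmetric under
  \<open>a \<mapsto> q - a\<close>, so that its largest value is \<open>u 0 = \<parallel>D A\<^sup>q\<parallel>\<^sup>2\<close>. An even word is one of the \<open>u a\<close>; an
  odd word is an inner product of two neighbours and lies below their mean. Because the total
  exponent \<open>2 q\<close> is even, neither positivity of \<open>A\<close> nor its spectral decomposition is used.\<close>

lemma inner_sandwich_le:
  assumes A: "hermitian A" and D: "hermitian D" and c: "\<And>v. norm (D *v v) \<le> c * norm v"
    and "k \<le> 2 * q"
  shows "inner (sandwich A D k (2 * q - k)) D \<le> c\<^sup>2 * (norm (mpow A q))\<^sup>2"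
proof -
  define u where "u a = (norm (sandwich A D a (q - a)))\<^sup>2" for a
  have u_inner: "u a = inner (sandwich A D (2 * a) (2 * q - 2 * a)) D" if "a \<le> q" for a
    using that by (simp add: u_def power2_norm_eq_inner inner_sandwich[OF A] mult_2)
  have amgm: "inner x y \<le> ((norm x)\<^sup>2 + (norm y)\<^sup>2) / 2" for x y :: "complex^'m^'m"
    using norm_cauchy_schwarz[of x y] sum_squares_bound[of "norm x" "norm y"] by simp
  have ends: "u q = u 0"
    using inner_hermitian_right[OF D, of "mpow A (2*q)" D] inner_hermitian_left[OF D, of "mpow A (2*q)" D]
    by (simp add: u_inner sandwich_def)
  have "2 * u a \<le> u (a - 1) + u (a + 1)" if "0 < a" "a < q" for a
  proof -
    have "u a = inner (sandwich A D (a - 1) (q - (a - 1))) (sandwich A D (a + 1) (q - (a + 1)))"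
      using that by (subst inner_sandwich[OF A], subst u_inner) (auto intro!: arg_cong2[where f=inner] arg_cong2[where f="sandwich A D"])
    also have "\<dots> \<le> (u (a - 1) + u (a + 1)) / 2"
      unfolding u_def by (rule amgm)
    finally show ?thesis by simp
  qed
  then have u0: "u a \<le> u 0" if "a \<le> q" for a
    using discrete_convex_chord[of q u a] that ends
    by (cases "q = 0") (auto simp: distrib_right[symmetric] of_nat_diff)
  have "u 0 \<le> c\<^sup>2 * (norm (mpow A q))\<^sup>2"
    using norm_matrix_mult_le[OF c] by (simp add: u_def sandwich_def)
  moreover have "inner (sandwich A D k (2 * q - k)) D \<le> u 0"
  proof (cases "even k")
    case True
    then obtain a where "k = 2 * a" by blast
    then show ?thesis using u0[of a] u_inner[of a] \<open>k \<le> 2 * q\<close> by simp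
  next
    case False
    then obtain a where k: "k = 2 * a + 1" by (auto elim: oddE)
    with \<open>k \<le> 2 * q\<close> have "a < q" by simp
    have "inner (sandwich A D k (2 * q - k)) D
        = inner (sandwich A D a (q - a)) (sandwich A D (a + 1) (q - (a + 1)))"
      using \<open>a < q\<close> k by (subst inner_sandwich[OF A]) (auto intro!: arg_cong2[where f=inner] arg_cong2[where f="sandwich A D"])
    also have "\<dots> \<le> (u a + u (a + 1)) / 2" unfolding u_def by (rule amgm)
    also have "\<dots> \<le> u 0" using u0[of a] u0[of "a + 1"] \<open>a < q\<close> by simp
    finally show ?thesis .
  qed
  ultimately show ?thesis by simp
qed

section \<open>The trace of an even power along a Hermitian perturbation\<close>

text \<open>The real part of \<open>tr (A\<^sup>p)\<close>, which for Hermitian \<open>A\<close> is the trace itself.\<close>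

definition trpow :: "complex^'m^'m \<Rightarrow> nat \<Rightarrow> real" where
  "trpow A p = inner (mat 1) (mpow A p)"

lemma trpow_add: "hermitian A \<Longrightarrow> trpow A (i + j) = inner (mpow A i) (mpow A j)"
  using inner_mpow_left[of A i "mat 1" "mpow A j"] by (simp add: trpow_def mpow_add)

lemma trpow_0: "trpow (A :: complex^'m^'m) 0 = real CARD('m)"
proof -
  have "inner (mat 1 $ i) ((mat 1 :: complex^'m^'m) $ i) = 1" for i :: 'm
    by (simp add: inner_vec_def mat_def sum.delta[where S=UNIV] if_distrib[where f="\<lambda>x. inner x _"] cong: if_cong)
  then show ?thesis by (simp add: trpow_def inner_vec_def[of "mat 1"])
qed

lemma trpow_even_nonneg: "hermitian A \<Longrightarrow> 0 \<le> trpow A (2 * q)"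
  by (simp add: mult_2 trpow_add)

text \<open>The sequence \<open>tr (A\<^sup>2\<^sup>a)\<close> is discretely convex in \<open>a\<close> and equals the dimension at \<open>a = 0\<close>. This
  closes the second-order differential inequality below, which otherwise would relate two different
  exponents; the price is a term that vanishes as \<open>q\<close> grows.\<close>

lemma trpow_lower:
  assumes A: "hermitian (A :: complex^'m^'m)"
  shows "trpow A (2 * q) \<le> trpow A (2 * (q + 1)) + real CARD('m) / (q + 1)"
proof -
  define v where "v a = trpow A (2 * a)" for a
  have "2 * v a \<le> v (a - 1) + v (a + 1)" if "0 < a" for a
  proof -
    have "v a = inner (mpow A (a - 1)) (mpow A (a + 1))"
      using that by (simp add: v_def trpow_add[OF A, symmetric] mult_2 flip: add_Suc_right)
    also have "\<dots> \<le> ((norm (mpow A (a - 1)))\<^sup>2 + (norm (mpow A (a + 1)))\<^sup>2) / 2"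
      using norm_cauchy_schwarz[of "mpow A (a - 1)" "mpow A (a + 1)"]
        sum_squares_bound[of "norm (mpow A (a - 1))" "norm (mpow A (a + 1))"] by simp
    also have "\<dots> = (v (a - 1) + v (a + 1)) / 2"
      unfolding v_def mult_2 trpow_add[OF A] power2_norm_eq_inner ..
    finally show ?thesis by simp
  qed
  then have "real (q + 1) * v q \<le> real 1 * v 0 + real q * v (q + 1)"
    using discrete_convex_chord[of "q + 1" v q] by simp
  moreover have "0 \<le> v (q + 1)" unfolding v_def by (rule trpow_even_nonneg[OF A])
  moreover have "v 0 = real CARD('m)" by (simp add: v_def trpow_0)
  ultimately have "real (q + 1) * v q \<le> real (q + 1) * v (q + 1) + real CARD('m)"
    by (simp add: algebra_simps)
  also have "\<dots> = real (q + 1) * (v (q + 1) + real CARD('m) / (q + 1))"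
    by (simp add: distrib_left)
  finally have "v q \<le> v (q + 1) + real CARD('m) / (q + 1)"
    by (rule mult_left_le_imp_le) simp
  then show ?thesis by (simp only: v_def)
qed

lemma has_vector_derivative_mpow:
  "((\<lambda>t. mpow (A + t *\<^sub>R D) p) has_vector_derivative
      (\<Sum>i<p. sandwich (A + t *\<^sub>R D) D i (p - 1 - i))) (at t)"
proof (induction p)
  case 0
  then show ?case by simp
next
  case (Suc p)
  let ?A = "A + t *\<^sub>R D"
  have "((\<lambda>t. A + t *\<^sub>R D) has_vector_derivative D) (at t)"
    by (auto intro!: derivative_eq_intros)
  from mmul.has_vector_derivative[OF this Suc.IH]
  have "((\<lambda>t. mpow (A + t *\<^sub>R D) (Suc p)) has_vector_derivative
      ?A ** (\<Sum>i<p. sandwich ?A D i (p - 1 - i)) + D ** mpow ?A p) (at t)" by simp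
  moreover have "?A ** (\<Sum>i<p. sandwich ?A D i (p - 1 - i)) + D ** mpow ?A p
      = (\<Sum>i<Suc p. sandwich ?A D i (Suc p - 1 - i))"
    by (simp add: sum.lessThan_Suc_shift mmul.sum_right sandwich_def matrix_mul_assoc del: sum.lessThan_Suc)
  ultimately show ?case by simp
qed

lemma has_derivative_trpow:
  assumes A: "hermitian A" and D: "hermitian D"
  shows "((\<lambda>t. trpow (A + t *\<^sub>R D) (Suc p)) has_real_derivative
     real (Suc p) * inner (mpow (A + t *\<^sub>R D) p) D) (at t)"
proof -
  let ?A = "A + t *\<^sub>R D"
  have H: "hermitian ?A" using A D by (intro hermitian_add hermitian_scaleR)
  have *: "inner (mat 1) (sandwich ?A D i (p - i)) = inner (mpow ?A p) D" if "i < Suc p" for i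
  proof -
    have "inner (mat 1) (sandwich ?A D i (p - i)) = inner (mpow ?A i ** mpow ?A (p - i)) D"
      using inner_mpow_left[OF H, of i "mat 1" "D ** mpow ?A (p - i)"]
        inner_mpow_right[OF H, of "mpow ?A i" "p - i" D]
      by (simp add: sandwich_def matrix_mul_assoc)
    then show ?thesis using that by (simp flip: mpow_add)
  qed
  have "((\<lambda>t. inner (mat 1) (mpow (A + t *\<^sub>R D) (Suc p))) has_vector_derivative
      inner (mat 1) (\<Sum>i<Suc p. sandwich ?A D i (Suc p - 1 - i))) (at t)"
    by (rule bounded_linear.has_vector_derivative[OF bounded_linear_inner_right has_vector_derivative_mpow])
  moreover have "inner (mat 1) (\<Sum>i<Suc p. sandwich ?A D i (Suc p - 1 - i))
      = real (Suc p) * inner (mpow ?A p) D"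
    using * by (simp add: inner_sum_right del: sum.lessThan_Suc)
  ultimately show ?thesis
    unfolding trpow_def has_real_derivative_iff_has_vector_derivative by simp
qed

text \<open>Sturm comparison with \<open>y'' = a\<^sup>2 y\<close>: the expression
  \<open>h' s * sinh (a * (1 - s)) / a + h s * cosh (a * (1 - s))\<close> takes the values of the two sides at
  \<open>s = 1\<close> and \<open>s = 0\<close>, and its derivative is a nonnegative multiple of \<open>h'' s - a\<^sup>2 * h s\<close>.\<close>

lemma cosh_comparison:
  fixes h h' h'' :: "real \<Rightarrow> real"
  assumes h: "\<And>t. (h has_real_derivative h' t) (at t)"
    and h': "\<And>t. (h' has_real_derivative h'' t) (at t)"
    and le: "\<And>t. h'' t \<le> a\<^sup>2 * h t" and a: "a > 0"
  shows "h 1 \<le> cosh a * h 0 + sinh a / a * h' 0"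
proof -
  define w where "w s = h' s * sinh (a * (1 - s)) / a + h s * cosh (a * (1 - s))" for s
  have "w 1 \<le> w 0"
  proof (rule DERIV_nonpos_imp_nonincreasing[of 0 1 w])
    fix s :: real assume s: "0 \<le> s" "s \<le> 1"
    have "(w has_real_derivative (h'' s - a\<^sup>2 * h s) * sinh (a * (1 - s)) / a) (at s)"
      unfolding w_def using a
      by (auto intro!: derivative_eq_intros h h' simp: field_simps power2_eq_square)
    moreover have "(h'' s - a\<^sup>2 * h s) * sinh (a * (1 - s)) / a \<le> 0"
      using le[of s] a s by (intro divide_nonpos_pos mult_nonpos_nonneg) auto
    ultimately show "\<exists>y. (w has_real_derivative y) (at s) \<and> y \<le> 0" by blast
  qed simp
  then show ?thesis by (simp add: w_def algebra_simps)
qed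

text \<open>A noncommutative version of \<open>e\<^sup>x\<^sup>+\<^sup>y \<le> e\<^sup>x (cosh c + (y / c) sinh c)\<close> for \<open>\<bar>y\<bar> \<le> c\<close>. Along
  \<open>t \<mapsto> A + t D\<close> the shifted trace \<open>h\<close> satisfies \<open>h'' \<le> (p c)\<^sup>2 h\<close>. The last term is linear in \<open>D\<close>
  and has mean zero when \<open>D\<close> is a martingale increment.\<close>

lemma trpow_perturbation:
  fixes A D :: "complex^'m^'m" and c \<delta> :: real and p q :: nat
  assumes A: "hermitian A" and D: "hermitian D"
    and c: "\<And>v. norm (D *v v) \<le> c * norm v" and "c > 0"
    and p: "p = 2 * (q + 1)" and \<delta>: "\<delta> = real CARD('m) / (q + 1)"
  shows "trpow (A + D) p + \<delta> \<le> cosh (p * c) * (trpow A p + \<delta>)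
           + sinh (p * c) / (p * c) * (p * inner (mpow A (p - 1)) D)"
proof -
  define h where "h t = trpow (A + t *\<^sub>R D) p + \<delta>" for t
  define h' where "h' t = real p * inner (mpow (A + t *\<^sub>R D) (p - 1)) D" for t
  define h'' where "h'' t = real p * (\<Sum>i<p - 1. inner (sandwich (A + t *\<^sub>R D) D i (p - 1 - 1 - i)) D)" for t
  have h: "(h has_real_derivative h' t) (at t)" for t
    unfolding h_def h'_def using has_derivative_trpow[OF A D, of "p - 1" t] p
    by (auto intro!: derivative_eq_intros)
  have h': "(h' has_real_derivative h'' t) (at t)" for t
    unfolding h'_def h''_def has_real_derivative_iff_has_vector_derivative inner_sum_left[symmetric]
    by (intro has_vector_derivative_mult_right bounded_linear.has_vector_derivative[OF bounded_linear_inner_left]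
        has_vector_derivative_mpow)
  have h'': "h'' t \<le> (real p * c)\<^sup>2 * h t" for t
  proof -
    let ?A = "A + t *\<^sub>R D"
    have H: "hermitian ?A" using A D by (intro hermitian_add hermitian_scaleR)
    have "inner (sandwich ?A D i (2 * q - i)) D \<le> c\<^sup>2 * trpow ?A (2 * q)" if "i < p - 1" for i
      using inner_sandwich_le[OF H D c, of i q] that p
      by (simp only: mult_2 trpow_add[OF H] power2_norm_eq_inner)
    then have "(\<Sum>i<p - 1. inner (sandwich ?A D i (2 * q - i)) D) \<le> real (p - 1) * (c\<^sup>2 * trpow ?A (2 * q))"
      using sum_bounded_above[of "{..<p - 1}" "\<lambda>i. inner (sandwich ?A D i (2 * q - i)) D"] by simp
    also have "\<dots> \<le> real p * (c\<^sup>2 * trpow ?A (2 * q))"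
      using trpow_even_nonneg[OF H, of q] by (intro mult_right_mono) auto
    also have "\<dots> \<le> real p * (c\<^sup>2 * h t)"
      using trpow_lower[OF H, of q] unfolding h_def \<delta> p by (intro mult_left_mono) auto
    finally have "h'' t \<le> real p * (real p * (c\<^sup>2 * h t))"
      using p by (auto simp: h''_def intro!: mult_left_mono)
    then show ?thesis by (simp add: power_mult_distrib power2_eq_square algebra_simps)
  qed
  have "0 < real p * c" using p \<open>c > 0\<close> by simp
  with h h' h'' have "h 1 \<le> cosh (p * c) * h 0 + sinh (p * c) / (p * c) * h' 0"
    by (rule cosh_comparison)
  then show ?thesis by (simp add: h_def h'_def)
qed

section \<open>The largest eigenvalue\<close>

lemma scalar_of_real_vec: "complex_of_real l *s v = l *\<^sub>R v"
  unfolding vec_eq_iff vector_scaleR_component by (simp add: scaleR_conv_of_real)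

text \<open>Eigenvectors for distinct real eigenvalues are orthogonal in the underlying real inner product
  space, which has finite dimension.\<close>

lemma finite_real_eigenvalues:
  assumes H: "hermitian (A :: complex^'m^'m)"
  shows "finite {l. \<exists>v. v \<noteq> 0 \<and> A *v v = complex_of_real l *s v}" (is "finite ?E")
proof -
  have "\<forall>l\<in>?E. \<exists>v. v \<noteq> 0 \<and> A *v v = l *\<^sub>R v" by (auto simp: scalar_of_real_vec)
  from bchoice[OF this] obtain e
    where e: "\<And>l. l \<in> ?E \<Longrightarrow> e l \<noteq> 0" "\<And>l. l \<in> ?E \<Longrightarrow> A *v e l = l *\<^sub>R e l"
    by blast
  have orth: "inner (e k) (e l) = 0" if "k \<in> ?E" "l \<in> ?E" "k \<noteq> l" for k l
    using inner_hermitian_vec[OF H, of "e k" "e l"] e(2)[OF that(1)] e(2)[OF that(2)] that(3) by simp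
  have inj: "inj_on e ?E"
    by (metis (no_types, lifting) e(1) inj_onI inner_eq_zero_iff orth)
  have "pairwise orthogonal (e ` ?E)"
    unfolding pairwise_def orthogonal_def using orth by (metis (no_types, lifting) imageE)
  then have "independent (e ` ?E)"
    by (rule pairwise_orthogonal_independent) (metis (no_types, lifting) e(1) imageE)
  then have "finite (e ` ?E)" using independent_bound by blast
  then show ?thesis using inj finite_imageD by blast
qed

text \<open>A maximiser of the Rayleigh quotient on the unit sphere is an eigenvector.\<close>

lemma ex_real_eigenvalue:
  assumes H: "hermitian (A :: complex^'m^'m)"
  shows "\<exists>l v. v \<noteq> 0 \<and> A *v v = complex_of_real l *s v"
proof -
  let ?S = "sphere (0 :: complex^'m) 1"
  obtain b :: "complex^'m" where "b \<in> Basis" by (rule SOME_Basis[THEN that])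
  then have "?S \<noteq> {}" by (auto intro!: exI[of _ b])
  moreover have "continuous_on ?S (\<lambda>v. inner v (A *v v))"
    by (intro continuous_intros)
  ultimately obtain v where v: "v \<in> ?S" and max: "\<And>w. w \<in> ?S \<Longrightarrow> inner w (A *v w) \<le> inner v (A *v v)"
    using continuous_attains_sup[of ?S "\<lambda>v. inner v (A *v v)"] by auto
  define l where "l = inner v (A *v v)"
  define B where "B w = l *\<^sub>R w - A *v w" for w
  have psd: "0 \<le> inner w (B w)" for w
  proof (cases "w = 0")
    case False
    have "inner (w /\<^sub>R norm w) (A *v (w /\<^sub>R norm w)) \<le> l"
      unfolding l_def using False by (intro max) simp
    then have "inner w (A *v w) / (norm w)\<^sup>2 \<le> l"
      by (simp add: mvec.scaleR_right power2_eq_square divide_inverse ac_simps)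
    then show ?thesis
      using False by (simp add: B_def inner_diff_right pos_divide_le_eq power2_norm_eq_inner)
  qed (simp add: B_def)
  have Bv: "inner v (B v) = 0"
    using v by (simp add: B_def inner_diff_right l_def flip: power2_norm_eq_inner)
  have self_adj: "inner x (B y) = inner (B x) y" for x y
    by (simp add: B_def inner_diff_left inner_diff_right inner_hermitian_vec[OF H])
  define w where "w = B v"
  have sym: "inner v (B w) = inner w w"
    using self_adj[of v w] by (simp add: w_def)
  have quad: "inner (v - s *\<^sub>R w) (B (v - s *\<^sub>R w)) = - 2 * s * inner w w + s\<^sup>2 * inner w (B w)" for s
  proof -
    have B: "B (v - s *\<^sub>R w) = w - s *\<^sub>R B w"
      unfolding w_def
      by (simp add: B_def mvec.diff_right mvec.scaleR_right algebra_simps)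
    moreover have "inner v w = 0" using Bv by (simp add: w_def)
    ultimately show ?thesis
      by (simp only: B) (simp add: inner_diff_left inner_diff_right sym power2_eq_square algebra_simps)
  qed
  have "inner w w = 0"
  proof (rule ccontr)
    assume "inner w w \<noteq> 0"
    then have pos: "inner w w > 0" by (metis inner_eq_zero_iff inner_gt_zero_iff)
    define r where "r = inner w (B w)"
    have "r \<ge> 0" unfolding r_def by (rule psd)
    \<comment> \<open>Any step shorter than \<open>2 * inner w w / r\<close> works; the summand \<open>1\<close> guards against \<open>r = 0\<close>.\<close>
    define s where "s = inner w w / (r + 1)"
    have "s > 0" using pos \<open>r \<ge> 0\<close> by (simp add: s_def)
    have "0 \<le> s * (- 2 * inner w w + s * r)"
      using psd[of "v - s *\<^sub>R w"] unfolding quad r_def by (simp add: power2_eq_square algebra_simps)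
    then have "2 * inner w w \<le> s * r" using \<open>s > 0\<close> by (simp add: zero_le_mult_iff)
    also have "s * r \<le> inner w w"
      using pos \<open>r \<ge> 0\<close> by (simp add: s_def field_simps)
    finally show False using pos by simp
  qed
  then have "A *v v = l *\<^sub>R v" by (simp add: w_def B_def)
  then show ?thesis using v by (intro exI[of _ l] exI[of _ v]) (auto simp: scalar_of_real_vec)
qed

text \<open>An eigenvector of \<open>A\<close> for its largest eigenvalue is an eigenvector of every power of \<open>1 + s A\<close>,
  and the Frobenius norm, whose square is the trace of an even power, bounds how far a vector is
  stretched.\<close>

lemma trpow_ge_lambda_max:
  assumes H: "hermitian (A :: complex^'m^'m)" and s: "s > 0" and t: "t > 0" and le: "t \<le> lambda_max A"
  shows "(1 + s * t) ^ (2 * q) \<le> trpow (mat 1 + s *\<^sub>R A) (2 * q)"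
proof -
  let ?E = "{l. \<exists>v. v \<noteq> 0 \<and> A *v v = complex_of_real l *s v}"
  let ?B = "mat 1 + s *\<^sub>R A"
  have HB: "hermitian ?B" using H by (intro hermitian_add hermitian_mat1 hermitian_scaleR)
  have "?E \<noteq> {}" using ex_real_eigenvalue[OF H] by auto
  then have "lambda_max A \<in> ?E"
    unfolding lambda_max_def by (intro Max_in finite_real_eigenvalues[OF H])
  then obtain v where v: "v \<noteq> 0" "A *v v = lambda_max A *\<^sub>R v" by (auto simp: scalar_of_real_vec)
  define x where "x = 1 + s * lambda_max A"
  have "?B *v v = x *\<^sub>R v"
    using v(2) by (simp add: x_def mvec.add_left mvec.scaleR_left algebra_simps)
  then have pw: "mpow ?B k *v v = (x ^ k) *\<^sub>R v" for k
    by (induction k) (simp_all add: matrix_vector_mul_assoc[symmetric] mvec.scaleR_right ac_simps)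
  have entry: "norm (Y *v v) \<le> norm Y * norm v" for Y :: "complex^'m^'m"
  proof -
    have "norm ((Y *v v) $ i) \<le> norm (Y $ i) * norm v" for i
    proof -
      have "norm ((Y *v v) $ i) \<le> (\<Sum>j\<in>UNIV. norm (Y$i$j) * norm (v$j))"
        unfolding matrix_vector_mult_def by (auto intro!: sum_norm_le simp: norm_mult)
      also have "\<dots> \<le> norm (Y $ i) * norm v"
        unfolding norm_vec_def using L2_set_mult_ineq[of "\<lambda>j. norm (Y$i$j)" "\<lambda>j. norm (v$j)" UNIV] by simp
      finally show ?thesis .
    qed
    then have "norm (Y *v v) \<le> L2_set (\<lambda>i. norm (Y $ i) * norm v) UNIV"
      unfolding norm_vec_def[of "Y *v v"] by (intro L2_set_mono) auto
    also have "\<dots> = norm Y * norm v"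
      by (simp add: norm_vec_def[of Y] L2_set_left_distrib)
    finally show ?thesis .
  qed
  have x: "1 + s * t \<le> x" using s le by (simp add: x_def)
  have "x ^ q * norm v \<le> norm (mpow ?B q) * norm v"
    using entry[of "mpow ?B q"] pw[of q] abs_ge_self[of "x ^ q"]
    by (auto intro: order_trans[OF mult_right_mono])
  then have "x ^ q \<le> norm (mpow ?B q)" using v(1) by simp
  moreover have "(1 + s * t) ^ q \<le> x ^ q" using x s t by (intro power_mono) auto
  ultimately have "((1 + s * t) ^ q)\<^sup>2 \<le> (norm (mpow ?B q))\<^sup>2"
    using s t by (intro power_mono) auto
  then show ?thesis
    by (simp add: trpow_add[OF HB] mult_2 dot_square_norm power2_eq_square power_add)
qed

section \<open>An Azuma inequality for Hermitian martingales\<close>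

lemma cosh_le_exp_square: "cosh x \<le> exp (x\<^sup>2 / 2)" for x :: real
proof -
  have *: "cosh y \<le> exp (y\<^sup>2 / 2)" if "0 \<le> y" for y :: real
  proof -
    have sinh_le: "sinh z \<le> z * cosh z" if "0 \<le> z" for z :: real
    proof -
      have "(\<lambda>s. sinh s - s * cosh s) z \<le> (\<lambda>s. sinh s - s * cosh s) 0"
      proof (rule DERIV_nonpos_imp_nonincreasing[OF that])
        fix s :: real assume "0 \<le> s" "s \<le> z"
        have "((\<lambda>s. sinh s - s * cosh s) has_real_derivative - (s * sinh s)) (at s)"
          by (auto intro!: derivative_eq_intros)
        moreover have "- (s * sinh s) \<le> 0" using \<open>0 \<le> s\<close> by simp
        ultimately show "\<exists>d. ((\<lambda>s. sinh s - s * cosh s) has_real_derivative d) (at s) \<and> d \<le> 0"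
          by blast
      qed
      then show ?thesis by simp
    qed
    let ?u = "\<lambda>s::real. cosh s * exp (- (s\<^sup>2 / 2))"
    have "?u y \<le> ?u 0"
    proof (rule DERIV_nonpos_imp_nonincreasing[OF that])
      fix s :: real assume "0 \<le> s" "s \<le> y"
      have "(?u has_real_derivative (sinh s - s * cosh s) * exp (- (s\<^sup>2 / 2))) (at s)"
        by (auto intro!: derivative_eq_intros simp: algebra_simps)
      moreover have "(sinh s - s * cosh s) * exp (- (s\<^sup>2 / 2)) \<le> 0"
        using sinh_le[OF \<open>0 \<le> s\<close>] by (simp add: mult_nonpos_nonneg)
      ultimately show "\<exists>d. (?u has_real_derivative d) (at s) \<and> d \<le> 0" by blast
    qed
    then show ?thesis by (simp add: exp_minus field_simps)
  qed
  from *[of "\<bar>x\<bar>"] show ?thesis by simp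
qed

lemma continuous_on_mpow: "continuous_on UNIV (\<lambda>A :: complex^'m^'m. mpow A k)"
  by (induction k) (auto intro!: mmul.continuous_on continuous_on_id)

lemma (in prob_space) integrable_inner_bounded:
  fixes f g :: "'a \<Rightarrow> 'b::euclidean_space"
  assumes "f \<in> borel_measurable M" "g \<in> borel_measurable M"
    and "\<And>\<omega>. norm (f \<omega>) \<le> K" "\<And>\<omega>. norm (g \<omega>) \<le> R"
  shows "integrable M (\<lambda>\<omega>. inner (f \<omega>) (g \<omega>))"
proof (rule integrable_const_bound[of _ "K * R"])
  have "\<bar>inner (f \<omega>) (g \<omega>)\<bar> \<le> K * R" for \<omega>
    using Cauchy_Schwarz_ineq2[of "f \<omega>" "g \<omega>"] mult_mono[OF assms(3)[of \<omega>] assms(4)[of \<omega>]]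
      norm_ge_zero[of "f \<omega>"] norm_ge_zero[of "g \<omega>"] assms(3)[of \<omega>]
    by linarith
  then show "AE \<omega> in M. norm (inner (f \<omega>) (g \<omega>)) \<le> K * R" by simp
qed (use assms in measurable)

lemma bounded_continuous_compose:
  fixes \<phi> :: "'b::euclidean_space \<Rightarrow> 'c::euclidean_space"
  assumes "continuous_on UNIV \<phi>" "\<And>\<omega>. norm (f \<omega>) \<le> R"
  shows "\<exists>K. \<forall>\<omega>. norm (\<phi> (f \<omega>)) \<le> K"
proof -
  have "compact (\<phi> ` cball 0 R)"
    by (intro compact_continuous_image continuous_on_subset[OF assms(1)]) auto
  then obtain K where "\<And>x. x \<in> \<phi> ` cball 0 R \<Longrightarrow> norm x \<le> K"
    using compact_imp_bounded bounded_iff by metis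
  then show ?thesis using assms(2) by (intro exI[of _ K]) auto
qed

text \<open>The martingale property is stated against continuous functions of the current value. It follows
  from the martingale property for any filtration to which \<open>W\<close> is adapted.\<close>

locale hermitian_martingale = prob_space M
  for M :: "'w measure" +
  fixes W :: "nat \<Rightarrow> 'w \<Rightarrow> complex^'m^'m" and C :: real
  assumes W_measurable: "\<And>b. W b \<in> borel_measurable M"
    and W_0: "\<And>\<omega>. W 0 \<omega> = 0"
    and W_hermitian: "\<And>b \<omega>. hermitian (W b \<omega>)"
    and W_step: "\<And>b \<omega> v. norm ((W (Suc b) \<omega> - W b \<omega>) *v v) \<le> C * norm v"
    and W_martingale: "\<And>b \<phi>. continuous_on UNIV \<phi> \<Longrightarrow>
        (\<integral>\<omega>. inner (\<phi> (W b \<omega>)) (W (Suc b) \<omega> - W b \<omega>) \<partial>M) = 0"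
    and C_pos: "C > 0"
begin

lemma norm_W_step: "norm (W (Suc b) \<omega> - W b \<omega>) \<le> C * norm (mat 1 :: complex^'m^'m)"
proof (rule power2_le_imp_le)
  show "(norm (W (Suc b) \<omega> - W b \<omega>))\<^sup>2 \<le> (C * norm (mat 1 :: complex^'m^'m))\<^sup>2"
    using norm_matrix_mult_le[OF W_step, where X = "mat 1"] by (simp add: power_mult_distrib)
qed (use C_pos in simp)

lemma norm_W: "norm (W b \<omega>) \<le> real b * (C * norm (mat 1 :: complex^'m^'m))"
proof (induction b)
  case (Suc b)
  have "norm (W (Suc b) \<omega>) \<le> norm (W b \<omega>) + norm (W (Suc b) \<omega> - W b \<omega>)"
    using norm_triangle_ineq[of "W b \<omega>" "W (Suc b) \<omega> - W b \<omega>"] by simp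
  with Suc norm_W_step[of b \<omega>] show ?case by (simp add: distrib_right)
qed (simp add: W_0)

lemma continuous_compose_W:
  fixes \<phi> :: "complex^'m^'m \<Rightarrow> 'c::euclidean_space"
  assumes "continuous_on UNIV \<phi>"
  shows "(\<lambda>\<omega>. \<phi> (W b \<omega>)) \<in> borel_measurable M" "\<exists>K. \<forall>\<omega>. norm (\<phi> (W b \<omega>)) \<le> K"
  using borel_measurable_continuous_onI[OF assms] W_measurable[of b] measurable_compose
    bounded_continuous_compose[OF assms, of "W b", OF norm_W]
  by auto

text \<open>The quantity \<open>E tr (1 + \<theta> W / p)\<^sup>p\<close> is a polynomial version of \<open>E tr exp (\<theta> W)\<close>. Each step
  multiplies it, shifted by \<open>\<delta>\<close>, by at most \<open>cosh (\<theta> C)\<close>, because the linear term of the perturbation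
  bound has mean zero.\<close>

lemma trpow_moment_bound:
  fixes \<theta> :: real and q :: nat
  assumes "\<theta> > 0"
  defines "p \<equiv> 2 * (q + 1)" and "\<delta> \<equiv> real CARD('m) / (q + 1)"
  shows "integrable M (\<lambda>\<omega>. trpow (mat 1 + (\<theta> / p) *\<^sub>R W b \<omega>) p)"
    and "(\<integral>\<omega>. trpow (mat 1 + (\<theta> / p) *\<^sub>R W b \<omega>) p \<partial>M) + \<delta> \<le> cosh (\<theta> * C) ^ b * (real CARD('m) + \<delta>)"
proof -
  define s where "s = \<theta> / p"
  have "s > 0" and ps: "real p * (s * C) = \<theta> * C" using assms(1) by (simp_all add: s_def p_def)
  have cont: "continuous_on UNIV (\<lambda>A :: complex^'m^'m. mpow (mat 1 + s *\<^sub>R A) k)" for k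
    by (rule continuous_on_compose2[OF continuous_on_mpow]) (auto intro!: continuous_intros)
  have int: "integrable M (\<lambda>\<omega>. trpow (mat 1 + s *\<^sub>R W b \<omega>) k)" for b k
  proof -
    obtain K where "\<And>\<omega>. norm (mpow (mat 1 + s *\<^sub>R W b \<omega>) k) \<le> K"
      using continuous_compose_W(2)[OF cont] by blast
    with continuous_compose_W(1)[OF cont] show ?thesis
      unfolding trpow_def by (intro integrable_inner_bounded) auto
  qed
  then show "integrable M (\<lambda>\<omega>. trpow (mat 1 + (\<theta> / p) *\<^sub>R W b \<omega>) p)" unfolding s_def .
  have "(\<integral>\<omega>. trpow (mat 1 + s *\<^sub>R W b \<omega>) p \<partial>M) + \<delta> \<le> cosh (\<theta> * C) ^ b * (real CARD('m) + \<delta>)"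
  proof (induction b)
    case 0
    have "mpow (mat 1 :: complex^'m^'m) k = mat 1" for k by (induction k) auto
    then have "trpow (mat 1 :: complex^'m^'m) p = real CARD('m)"
      using trpow_0 by (simp add: trpow_def)
    then show ?case by (simp add: W_0 prob_space)
  next
    case (Suc b)
    define A where "A \<omega> = mat 1 + s *\<^sub>R W b \<omega>" for \<omega>
    define Y where "Y \<omega> = W (Suc b) \<omega> - W b \<omega>" for \<omega>
    define \<gamma> where "\<gamma> = sinh (\<theta> * C) / (\<theta> * C) * (p * s)"
    have pointwise: "trpow (mat 1 + s *\<^sub>R W (Suc b) \<omega>) p
        \<le> cosh (\<theta> * C) * (trpow (A \<omega>) p + \<delta>) + \<gamma> * inner (mpow (A \<omega>) (p - 1)) (Y \<omega>) - \<delta>" for \<omega>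
    proof -
      have "norm ((s *\<^sub>R Y \<omega>) *v v) \<le> s * C * norm v" for v
        using mult_left_mono[OF W_step[of b \<omega> v], of s] \<open>s > 0\<close>
        by (simp add: Y_def mvec.scaleR_left ac_simps)
      then have "trpow (A \<omega> + s *\<^sub>R Y \<omega>) p + \<delta> \<le> cosh (p * (s * C)) * (trpow (A \<omega>) p + \<delta>)
           + sinh (p * (s * C)) / (p * (s * C)) * (p * inner (mpow (A \<omega>) (p - 1)) (s *\<^sub>R Y \<omega>))"
        using \<open>s > 0\<close> C_pos unfolding A_def Y_def
        by (intro trpow_perturbation[where q = q] hermitian_add hermitian_mat1 hermitian_scaleR
            hermitian_diff W_hermitian) (simp_all add: p_def \<delta>_def)
      moreover have "A \<omega> + s *\<^sub>R Y \<omega> = mat 1 + s *\<^sub>R W (Suc b) \<omega>"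
        by (simp add: A_def Y_def algebra_simps)
      ultimately show ?thesis by (simp add: ps \<gamma>_def)
    qed
    obtain K where "\<And>\<omega>. norm (mpow (A \<omega>) (p - 1)) \<le> K"
      using continuous_compose_W(2)[OF cont] unfolding A_def by blast
    then have int': "integrable M (\<lambda>\<omega>. inner (mpow (A \<omega>) (p - 1)) (Y \<omega>))"
      unfolding A_def Y_def
      by (intro integrable_inner_bounded[OF continuous_compose_W(1)[OF cont] _ _ norm_W_step])
        (use W_measurable in auto)
    have intA: "integrable M (\<lambda>\<omega>. trpow (A \<omega>) p)" unfolding A_def by (rule int)
    have "(\<integral>\<omega>. trpow (mat 1 + s *\<^sub>R W (Suc b) \<omega>) p \<partial>M)
        \<le> (\<integral>\<omega>. cosh (\<theta> * C) * (trpow (A \<omega>) p + \<delta>) + \<gamma> * inner (mpow (A \<omega>) (p - 1)) (Y \<omega>) - \<delta> \<partial>M)"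
      by (intro integral_mono int pointwise Bochner_Integration.integrable_diff
          Bochner_Integration.integrable_add integrable_mult_right int' intA) auto
    also have "\<dots> = cosh (\<theta> * C) * ((\<integral>\<omega>. trpow (A \<omega>) p \<partial>M) + \<delta>) - \<delta>"
      using W_martingale[OF cont[of "p - 1"], of b] int' intA
      by (simp add: A_def[symmetric] Y_def[symmetric] prob_space)
    also have "\<dots> \<le> cosh (\<theta> * C) * (cosh (\<theta> * C) ^ b * (real CARD('m) + \<delta>)) - \<delta>"
      using Suc unfolding A_def by (intro diff_right_mono mult_left_mono) (auto simp: less_imp_le)
    finally show ?case by (simp add: ac_simps)
  qed
  then show "(\<integral>\<omega>. trpow (mat 1 + (\<theta> / p) *\<^sub>R W b \<omega>) p \<partial>M) + \<delta>
      \<le> cosh (\<theta> * C) ^ b * (real CARD('m) + \<delta>)"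
    unfolding s_def .
qed

text \<open>Markov's inequality for the trace of a high power; letting the power tend to infinity turns
  \<open>(1 + \<theta> t / N)\<^sup>N\<close> into \<open>exp (\<theta> t)\<close> and removes the error term of the moment bound.\<close>

lemma lambda_max_tail:
  assumes "b > 0" "t > 0"
  shows "measure M {\<omega> \<in> space M. t \<le> lambda_max (W b \<omega>)}
    \<le> real CARD('m) * exp (- (t\<^sup>2 / (2 * real b * C\<^sup>2)))"
proof -
  \<comment> \<open>the minimiser of \<open>b (\<theta> C)\<^sup>2 / 2 - \<theta> t\<close>\<close>
  define \<theta> where "\<theta> = t / (real b * C\<^sup>2)"
  have \<theta>: "\<theta> > 0" using assms C_pos by (simp add: \<theta>_def)
  define Pr where "Pr = measure M {\<omega> \<in> space M. t \<le> lambda_max (W b \<omega>)}"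
  define N where "N q = 2 * (q + 1)" for q :: nat
  have bound: "Pr * (1 + \<theta> * t / N q) ^ N q \<le> cosh (\<theta> * C) ^ b * (real CARD('m) + real CARD('m) / (q + 1))"
    for q
  proof -
    let ?f = "\<lambda>\<omega>. trpow (mat 1 + (\<theta> / N q) *\<^sub>R W b \<omega>) (N q)"
    have "N q > 0" by (simp add: N_def)
    have pos: "0 < (1 + \<theta> * t / N q) ^ N q"
      using \<theta> assms by (intro zero_less_power add_pos_nonneg) auto
    have nn: "0 \<le> ?f \<omega>" for \<omega>
      unfolding N_def by (intro trpow_even_nonneg hermitian_add hermitian_mat1 hermitian_scaleR W_hermitian)
    have int: "integrable M ?f" using trpow_moment_bound(1)[OF \<theta>, of q b] by (simp only: N_def)
    have "{\<omega> \<in> space M. t \<le> lambda_max (W b \<omega>)}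
        \<subseteq> {\<omega> \<in> space M. (1 + \<theta> * t / N q) ^ N q \<le> ?f \<omega>}"
      using trpow_ge_lambda_max[OF W_hermitian, of "\<theta> / N q" t b _ "q + 1"] \<theta> assms \<open>N q > 0\<close>
      by (auto simp: N_def)
    then have "Pr \<le> measure M {\<omega> \<in> space M. (1 + \<theta> * t / N q) ^ N q \<le> ?f \<omega>}"
      unfolding Pr_def using int by (intro finite_measure_mono) auto
    also have "\<dots> \<le> (\<integral>\<omega>. ?f \<omega> \<partial>M) / (1 + \<theta> * t / N q) ^ N q"
      using pos nn by (intro integral_Markov_inequality_measure[OF int, where A = "space M"]) auto
    finally have "Pr * (1 + \<theta> * t / N q) ^ N q \<le> (\<integral>\<omega>. ?f \<omega> \<partial>M)"
      using pos by (simp add: pos_le_divide_eq)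
    also have "\<dots> \<le> cosh (\<theta> * C) ^ b * (real CARD('m) + real CARD('m) / (q + 1))"
    proof -
      have "(\<integral>\<omega>. ?f \<omega> \<partial>M) + real CARD('m) / (q + 1)
          \<le> cosh (\<theta> * C) ^ b * (real CARD('m) + real CARD('m) / (q + 1))"
        using trpow_moment_bound(2)[OF \<theta>, of q b] by (simp only: N_def)
      moreover have "0 \<le> real CARD('m) / (q + 1)" by simp
      ultimately show ?thesis by linarith
    qed
    finally show ?thesis .
  qed
  have "filterlim N at_top sequentially"
    unfolding N_def by (rule filterlim_subseq) (auto simp: strict_mono_def)
  then have "(\<lambda>q. (1 + \<theta> * t / N q) ^ N q) \<longlonglongrightarrow> exp (\<theta> * t)"
    by (rule filterlim_compose[OF tendsto_exp_limit_sequentially])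
  then have "(\<lambda>q. Pr * (1 + \<theta> * t / N q) ^ N q) \<longlonglongrightarrow> Pr * exp (\<theta> * t)"
    by (rule tendsto_mult_left)
  moreover have "(\<lambda>q. cosh (\<theta> * C) ^ b * (real CARD('m) + real CARD('m) / real (q + 1)))
      \<longlonglongrightarrow> cosh (\<theta> * C) ^ b * (real CARD('m) + 0)"
    by (intro tendsto_intros) (use LIMSEQ_ignore_initial_segment[OF lim_const_over_n[of "real CARD('m)"], of 1] in \<open>simp add: add.commute\<close>)
  ultimately have "Pr * exp (\<theta> * t) \<le> cosh (\<theta> * C) ^ b * (real CARD('m) + 0)"
    by (rule LIMSEQ_le) (use bound in blast)
  also have "\<dots> \<le> exp ((\<theta> * C)\<^sup>2 / 2) ^ b * real CARD('m)"
    by (auto intro!: mult_right_mono power_mono cosh_le_exp_square simp: less_imp_le)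
  also have "\<dots> = exp (real b * ((\<theta> * C)\<^sup>2 / 2)) * real CARD('m)"
    by (simp only: exp_of_nat_mult)
  finally have "Pr * exp (\<theta> * t) \<le> exp (real b * ((\<theta> * C)\<^sup>2 / 2)) * real CARD('m)" .
  then have "Pr \<le> exp (real b * ((\<theta> * C)\<^sup>2 / 2)) * real CARD('m) / exp (\<theta> * t)"
    by (simp add: pos_le_divide_eq)
  also have "\<dots> = real CARD('m) * exp (real b * ((\<theta> * C)\<^sup>2 / 2) - \<theta> * t)"
    by (simp add: exp_diff)
  also have "real b * ((\<theta> * C)\<^sup>2 / 2) - \<theta> * t = - (t\<^sup>2 / (2 * real b * C\<^sup>2))"
    using assms C_pos by (simp add: \<theta>_def field_simps power2_eq_square)
  finally show ?thesis unfolding Pr_def .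
qed

end

section \<open>The operator norm under averaging\<close>

lemma norm_mult_vec_le_op_norm: "norm (A *v v) \<le> op_norm A * norm v"
  unfolding op_norm_def by (intro onorm matrix_vector_mul_bounded_linear)

lemma op_norm_leI: "(\<And>v. norm (A *v v) \<le> c * norm v) \<Longrightarrow> op_norm A \<le> c"
  unfolding op_norm_def by (rule onorm_le)

lemma op_norm_nonneg: "0 \<le> op_norm A"
  unfolding op_norm_def by (intro onorm_pos_le matrix_vector_mul_bounded_linear)

lemma op_norm_0 [simp]: "op_norm 0 = 0"
  by (intro antisym op_norm_nonneg op_norm_leI) simp

lemma op_norm_minus_commute: "op_norm (A - B) = op_norm (B - A)"
  by (simp add: op_norm_def mvec.diff_left norm_minus_commute onorm_def)

lemma op_norm_sum_le: "op_norm (sum A I) \<le> (\<Sum>i\<in>I. op_norm (A i))"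
proof (rule op_norm_leI)
  fix v
  have "norm (sum A I *v v) \<le> (\<Sum>i\<in>I. norm (A i *v v))"
    unfolding mvec.sum_left by (rule norm_sum)
  also have "\<dots> \<le> (\<Sum>i\<in>I. op_norm (A i)) * norm v"
    unfolding sum_distrib_right by (intro sum_mono norm_mult_vec_le_op_norm)
  finally show "norm (sum A I *v v) \<le> (\<Sum>i\<in>I. op_norm (A i)) * norm v" .
qed

lemma norm_le_op_norm: "norm (A :: complex^'m^'m) \<le> op_norm A * norm (mat 1 :: complex^'m^'m)"
proof (rule power2_le_imp_le)
  show "(norm A)\<^sup>2 \<le> (op_norm A * norm (mat 1 :: complex^'m^'m))\<^sup>2"
    using norm_matrix_mult_le[OF norm_mult_vec_le_op_norm, of A "mat 1"] by (simp add: power_mult_distrib)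
qed (simp add: op_norm_nonneg)

lemma norm_integral_le_integral:
  fixes f :: "'a \<Rightarrow> 'b::{banach,second_countable_topology}"
  assumes "integrable Q f" "integrable Q g" "\<And>x. norm (f x) \<le> g x"
  shows "norm (\<integral>x. f x \<partial>Q) \<le> (\<integral>x. g x \<partial>Q)"
  by (rule order_trans[OF integral_norm_bound integral_mono]) (use assms in auto)

lemma (in prob_space) op_norm_diff_integral_le:
  fixes g :: "'a \<Rightarrow> complex^'m^'m"
  assumes int: "integrable M g" and le: "\<And>y. op_norm (A - g y) \<le> c"
  shows "op_norm (A - (\<integral>y. g y \<partial>M)) \<le> c"
proof (rule op_norm_leI)
  fix v
  have "(A - (\<integral>y. g y \<partial>M)) *v v = (\<integral>y. (A - g y) *v v \<partial>M)"
    using int by (subst integral_bounded_linear[OF mvec.bounded_linear_left])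
      (auto simp: prob_space)
  also have "norm \<dots> \<le> (\<integral>y. c * norm v \<partial>M)"
  proof (rule norm_integral_le_integral)
    show "integrable M (\<lambda>y. (A - g y) *v v)"
      using int by (intro integrable_bounded_linear[OF mvec.bounded_linear_left]) auto
    show "norm ((A - g y) *v v) \<le> c * norm v" for y
      by (rule order_trans[OF norm_mult_vec_le_op_norm mult_right_mono[OF le]]) simp
  qed simp
  finally show "norm ((A - (\<integral>y. g y \<partial>M)) *v v) \<le> c * norm v" by (simp add: prob_space)
qed

lemma hermitian_integral:
  fixes g :: "'a \<Rightarrow> complex^'m^'m"
  assumes "\<And>y. hermitian (g y)"
  shows "hermitian (\<integral>y. g y \<partial>Q)"
proof (cases "integrable Q g")
  case True
  have entry: "(\<integral>y. g y \<partial>Q) $ i $ j = (\<integral>y. g y $ i $ j \<partial>Q)" for i j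
    using integral_bounded_linear[OF bounded_linear_compose[OF bounded_linear_vec_nth[of j] bounded_linear_vec_nth[of i]] True]
    by simp
  show ?thesis
    by (rule hermitianI) (simp only: entry Bochner_Integration.integral_cnj[symmetric] hermitian_cnj[OF assms])
qed (simp add: not_integrable_integral_eq hermitian_0)

section \<open>The Markov property and conditional means\<close>

lemma (in prob_space) integrable_bounded:
  fixes f :: "'a \<Rightarrow> 'b::{banach,second_countable_topology}"
  assumes "f \<in> borel_measurable M" "\<And>x. norm (f x) \<le> K"
  shows "integrable M f"
  using assms by (intro integrable_const_bound[of _ K]) auto

lemma (in prob_space) norm_integral_le:
  fixes f :: "'a \<Rightarrow> 'b::{banach,second_countable_topology}"
  assumes "\<And>x. norm (f x) \<le> K"
  shows "norm (\<integral>x. f x \<partial>M) \<le> K"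
proof (cases "integrable M f")
  case True
  then have "norm (\<integral>x. f x \<partial>M) \<le> (\<integral>x. K \<partial>M)"
    using assms by (intro norm_integral_le_integral) auto
  then show ?thesis by (simp add: prob_space)
next
  case False
  then show ?thesis using order_trans[OF norm_ge_zero assms] by (simp add: not_integrable_integral_eq)
qed

context markov_chain
begin

lemma kernel_prob:
  assumes "t \<ge> 1"
  shows "prob_space (P t x)" "sets (P t x) = sets borel" "space (P t x) = UNIV"
proof -
  have "P t x \<in> space (prob_algebra borel)"
    using measurable_space[OF kernel[OF assms], of x] by simp
  then show "prob_space (P t x)" and s: "sets (P t x) = sets borel"
    by (auto simp: space_prob_algebra)
  show "space (P t x) = UNIV" using sets_eq_imp_space_eq[OF s] by simp
qed

lemma kernel_measurable: "t \<ge> 1 \<Longrightarrow> P t x \<rightarrow>\<^sub>M N = borel \<rightarrow>\<^sub>M N"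
  by (intro measurable_cong_sets kernel_prob refl)

lemma kernel_integral_measurable:
  fixes g :: "'a \<Rightarrow> 'c::{banach,second_countable_topology}"
  assumes "t \<ge> 1" "g \<in> borel_measurable borel"
  shows "(\<lambda>x. \<integral>y. g y \<partial>P t x) \<in> borel_measurable borel"
  by (rule measurable_compose[OF measurable_prob_algebraD[OF kernel[OF assms(1)]]
        integral_measurable_subprob_algebra[OF assms(2)]])

lemma space_past: "space (past M X t) = space M"
  and sets_past: "sets (past M X t)
    = sigma_sets (space M) {X s -` A \<inter> space M | s A. s < t \<and> A \<in> sets borel}"
proof -
  have *: "{X s -` A \<inter> space M | s A. s < t \<and> A \<in> sets borel} \<subseteq> Pow (space M)" by auto
  show "space (past M X t) = space M"
    unfolding past_def using * by (rule space_measure_of)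
  show "sets (past M X t) = sigma_sets (space M) {X s -` A \<inter> space M | s A. s < t \<and> A \<in> sets borel}"
    unfolding past_def using * by (rule sets_measure_of)
qed

lemma subalgebra_past: "subalgebra M (past M X t)"
proof -
  have "{X s -` A \<inter> space M | s A. s < t \<and> A \<in> sets borel} \<subseteq> sets M"
    using measurable_sets[OF X_measurable] by auto
  then show ?thesis
    unfolding subalgebra_def space_past sets_past by (auto dest: sets.sigma_sets_subset)
qed

lemma X_past: "s < t \<Longrightarrow> X s \<in> past M X t \<rightarrow>\<^sub>M borel"
  by (intro measurableI) (auto simp: space_past sets_past)

text \<open>The defining property of the chain concerns indicators of sets. It extends to bounded
  nonnegative functions by linearity and dominated convergence.\<close>

lemma markov_real:
  fixes h :: "'w \<Rightarrow> real" and u :: "'a \<Rightarrow> real"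
  assumes t: "t \<ge> 1" and h: "h \<in> borel_measurable (past M X t)" and hK: "\<And>\<omega>. \<bar>h \<omega>\<bar> \<le> K"
    and u: "u \<in> borel_measurable borel" "\<And>x. 0 \<le> u x" and uR: "\<And>x. u x \<le> R"
  shows "(\<integral>\<omega>. h \<omega> * u (X t \<omega>) \<partial>M) = (\<integral>\<omega>. h \<omega> * (\<integral>y. u y \<partial>P t (X (t - 1) \<omega>)) \<partial>M)"
proof -
  interpret sigma_finite_subalgebra M "past M X t"
    by (intro finite_measure_subalgebra_is_sigma_finite finite_measure_subalgebra.intro
        finite_measure_axioms finite_measure_subalgebra_axioms.intro subalgebra_past)
  note [measurable] = X_measurable
  have hM [measurable]: "h \<in> borel_measurable M"
    by (rule measurable_from_subalg[OF subalgebra_past h])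
  have K0: "0 \<le> K" using order_trans[OF abs_ge_zero hK] .
  have meas_mean: "(\<lambda>\<omega>. \<integral>y. v y \<partial>P t (X (t - 1) \<omega>)) \<in> borel_measurable M"
    if "v \<in> borel_measurable borel" for v :: "'a \<Rightarrow> real"
    using measurable_compose[OF X_measurable kernel_integral_measurable[OF t that]] .
  have "\<forall>R. (\<forall>x. u x \<le> R) \<longrightarrow>
     (\<integral>\<omega>. h \<omega> * u (X t \<omega>) \<partial>M) = (\<integral>\<omega>. h \<omega> * (\<integral>y. u y \<partial>P t (X (t - 1) \<omega>)) \<partial>M)"
    using u
  proof (induction u rule: borel_measurable_induct_real)
    case (set A)
    have "(\<integral>\<omega>. h \<omega> * indicator A (X t \<omega>) \<partial>M)
        = (\<integral>\<omega>. h \<omega> * real_cond_exp M (past M X t) (\<lambda>\<omega>. indicator A (X t \<omega>)) \<omega> \<partial>M)"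
    proof (rule real_cond_exp_intg(2)[symmetric, OF _ h])
      show "integrable M (\<lambda>\<omega>. h \<omega> * indicator A (X t \<omega>))"
        using set hK K0 by (intro integrable_bounded[of _ K]) (auto simp: indicator_def)
    qed (use set in measurable)
    also have "\<dots> = (\<integral>\<omega>. h \<omega> * (\<integral>y. indicator A y \<partial>P t (X (t - 1) \<omega>)) \<partial>M)"
    proof (rule integral_cong_AE)
      show "(\<lambda>\<omega>. h \<omega> * (\<integral>y. indicator A y \<partial>P t (X (t - 1) \<omega>))) \<in> borel_measurable M"
        using meas_mean[of "indicator A"] set by simp
      show "AE \<omega> in M. h \<omega> * real_cond_exp M (past M X t) (\<lambda>\<omega>. indicator A (X t \<omega>)) \<omega>
          = h \<omega> * (\<integral>y. indicator A y \<partial>P t (X (t - 1) \<omega>))"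
        using markov[OF t set] by eventually_elim (simp add: kernel_prob[OF t])
    qed measurable
    finally show ?case by blast
  next
    case (mult u c)
    show ?case
    proof (cases "c = 0")
      case False
      show ?thesis
      proof (intro allI impI)
        fix R assume "\<forall>x. c * u x \<le> R"
        then have "\<forall>x. u x \<le> R / c" using False mult.hyps(1) by (simp add: pos_le_divide_eq mult.commute)
        with mult.IH have "(\<integral>\<omega>. h \<omega> * u (X t \<omega>) \<partial>M) = (\<integral>\<omega>. h \<omega> * (\<integral>y. u y \<partial>P t (X (t - 1) \<omega>)) \<partial>M)"
          by blast
        then show "(\<integral>\<omega>. h \<omega> * (c * u (X t \<omega>)) \<partial>M) = (\<integral>\<omega>. h \<omega> * (\<integral>y. c * u y \<partial>P t (X (t - 1) \<omega>)) \<partial>M)"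
          by (simp add: mult.left_commute)
      qed
    qed simp
  next
    case (add u v)
    show ?case
    proof (intro allI impI)
      fix R assume R: "\<forall>x. v x + u x \<le> R"
      have uR: "0 \<le> u x" "u x \<le> R" and vR: "0 \<le> v x" "v x \<le> R" for x
        using R[rule_format, of x] add.hyps(2)[of x] add.hyps(4)[of x] by auto
      have int: "integrable M (\<lambda>\<omega>. h \<omega> * w (X t \<omega>))"
          "integrable M (\<lambda>\<omega>. h \<omega> * (\<integral>y. w y \<partial>P t (X (t - 1) \<omega>)))" "integrable (P t x) w"
        if [measurable]: "w \<in> borel_measurable borel" and w: "\<And>x. 0 \<le> w x" "\<And>x. w x \<le> R" for w x
      proof -
        have "norm (\<integral>y. w y \<partial>P t x) \<le> R" for x
          using w by (intro prob_space.norm_integral_le[OF kernel_prob(1)[OF t]]) auto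
        then show "integrable M (\<lambda>\<omega>. h \<omega> * (\<integral>y. w y \<partial>P t (X (t - 1) \<omega>)))"
          using meas_mean[OF that(1)] hK K0
          by (intro integrable_bounded[of _ "K * R"]) (auto simp: abs_mult intro!: mult_mono)
        show "integrable M (\<lambda>\<omega>. h \<omega> * w (X t \<omega>))"
          using hK K0 w by (intro integrable_bounded[of _ "K * R"]) (auto simp: abs_mult intro!: mult_mono)
        show "integrable (P t x) w"
          using w by (intro prob_space.integrable_bounded[OF kernel_prob(1)[OF t], where K = R])
            (auto simp: kernel_measurable[OF t])
      qed
      have IH: "(\<integral>\<omega>. h \<omega> * w (X t \<omega>) \<partial>M) = (\<integral>\<omega>. h \<omega> * (\<integral>y. w y \<partial>P t (X (t - 1) \<omega>)) \<partial>M)"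
        if "w = u \<or> w = v" for w
        using that add.IH uR vR by blast
      show "(\<integral>\<omega>. h \<omega> * (v (X t \<omega>) + u (X t \<omega>)) \<partial>M)
          = (\<integral>\<omega>. h \<omega> * (\<integral>y. v y + u y \<partial>P t (X (t - 1) \<omega>)) \<partial>M)"
        using int[OF add.hyps(1) uR] int[OF add.hyps(3) vR] IH[of u] IH[of v]
        by (simp add: distrib_left)
    qed
  next
    case (seq U)
    show ?case
    proof (intro allI impI)
      fix R assume R: "\<forall>x. u x \<le> R"
      have lim: "(\<lambda>i. U i x) \<longlonglongrightarrow> u x" for x using seq.hyps(4)[of x] by simp
      have UR: "U i x \<le> R" for i x
        using incseq_le[OF _ lim[of x], of i] seq.hyps(3) R[rule_format, of x]
        by (force simp: mono_def le_fun_def)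
      have UR': "norm (U i x) \<le> R" for i x using UR seq.hyps(2)[of i x] by auto
      have meanR: "norm (\<integral>y. U i y \<partial>P t x) \<le> R" for i x
        by (rule prob_space.norm_integral_le[OF kernel_prob(1)[OF t] UR'])
      note [measurable] = u(1) seq.hyps(1) borel_measurable_LIMSEQ_real[OF lim seq.hyps(1)]
      have umeas: "u \<in> borel_measurable borel" by measurable
      have inner: "(\<lambda>i. \<integral>y. U i y \<partial>P t x) \<longlonglongrightarrow> (\<integral>y. u y \<partial>P t x)" for x
      proof (rule integral_dominated_convergence[where w="\<lambda>_. R"])
        show "integrable (P t x) (\<lambda>_. R)"
          using prob_space.finite_measure[OF kernel_prob(1)[OF t]]
          by (simp add: finite_measure.integrable_const)
      qed (use seq.hyps(1) umeas lim UR' in \<open>auto simp: kernel_measurable[OF t]\<close>)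
      have hb: "\<bar>h \<omega> * a\<bar> \<le> K * R" if "norm a \<le> R" for \<omega> and a :: real
        using that hK K0 by (auto simp: abs_mult intro!: mult_mono)
      have "(\<lambda>i. \<integral>\<omega>. h \<omega> * U i (X t \<omega>) \<partial>M) \<longlonglongrightarrow> (\<integral>\<omega>. h \<omega> * u (X t \<omega>) \<partial>M)"
        by (rule integral_dominated_convergence[where w="\<lambda>_. K * R"])
          (use umeas seq.hyps(1) in \<open>auto intro!: tendsto_intros lim hb UR'\<close>)
      moreover have "(\<lambda>i. \<integral>\<omega>. h \<omega> * (\<integral>y. U i y \<partial>P t (X (t - 1) \<omega>)) \<partial>M)
          \<longlonglongrightarrow> (\<integral>\<omega>. h \<omega> * (\<integral>y. u y \<partial>P t (X (t - 1) \<omega>)) \<partial>M)"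
        by (rule integral_dominated_convergence[where w="\<lambda>_. K * R"])
          (use meas_mean[OF umeas] meas_mean[OF seq.hyps(1)] in \<open>auto intro!: tendsto_intros inner hb meanR\<close>)
      moreover have "(\<integral>\<omega>. h \<omega> * U i (X t \<omega>) \<partial>M) = (\<integral>\<omega>. h \<omega> * (\<integral>y. U i y \<partial>P t (X (t - 1) \<omega>)) \<partial>M)" for i
        using seq.IH[of i] UR by blast
      ultimately show "(\<integral>\<omega>. h \<omega> * u (X t \<omega>) \<partial>M) = (\<integral>\<omega>. h \<omega> * (\<integral>y. u y \<partial>P t (X (t - 1) \<omega>)) \<partial>M)"
        using LIMSEQ_unique by simp
    qed
  qed
  then show ?thesis using uR by blast
qed

lemma markov_inner:
  fixes h :: "'w \<Rightarrow> 'c::euclidean_space" and g :: "'a \<Rightarrow> 'c"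
  assumes t: "t \<ge> 1" and h: "h \<in> borel_measurable (past M X t)" and hK: "\<And>\<omega>. norm (h \<omega>) \<le> K"
    and g: "g \<in> borel_measurable borel" and gR: "\<And>x. norm (g x) \<le> R"
  shows "(\<integral>\<omega>. inner (h \<omega>) (g (X t \<omega>)) \<partial>M) = (\<integral>\<omega>. inner (h \<omega>) (\<integral>y. g y \<partial>P t (X (t - 1) \<omega>)) \<partial>M)"
proof -
  note [measurable] = X_measurable g
  have hM [measurable]: "h \<in> borel_measurable M"
    by (rule measurable_from_subalg[OF subalgebra_past h])
  have intg: "integrable (P t x) g" for x
    by (rule prob_space.integrable_bounded[OF kernel_prob(1)[OF t] _ gR]) (simp add: kernel_measurable[OF t])
  have K0: "0 \<le> K" using order_trans[OF norm_ge_zero hK] .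
  have meas_mean: "(\<lambda>\<omega>. \<integral>y. v y \<partial>P t (X (t - 1) \<omega>)) \<in> borel_measurable M"
    if "v \<in> borel_measurable borel" for v :: "'a \<Rightarrow> real"
    using measurable_compose[OF X_measurable kernel_integral_measurable[OF t that]] .
  have comp: "(\<integral>\<omega>. inner (h \<omega>) b * inner (g (X t \<omega>)) b \<partial>M)
      = (\<integral>\<omega>. inner (h \<omega>) b * (\<integral>y. inner (g y) b \<partial>P t (X (t - 1) \<omega>)) \<partial>M)" (is "?L = ?R")
    and int: "integrable M (\<lambda>\<omega>. inner (h \<omega>) b * inner (g (X t \<omega>)) b)"
      "integrable M (\<lambda>\<omega>. inner (h \<omega>) b * (\<integral>y. inner (g y) b \<partial>P t (X (t - 1) \<omega>)))"
    if b: "b \<in> Basis" for b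
  proof -
    have hb: "\<bar>inner (h \<omega>) b\<bar> \<le> K" for \<omega> using Basis_le_norm[OF b] hK order_trans by blast
    have gb: "\<bar>inner (g x) b\<bar> \<le> R" for x using Basis_le_norm[OF b] gR order_trans by blast
    \<comment> \<open>The scalar Markov property is for nonnegative functions, so the component is shifted by \<open>R\<close>.\<close>
    have mean: "(\<integral>y. inner (g y) b + R \<partial>P t x) = (\<integral>y. inner (g y) b \<partial>P t x) + R" for x
      using intg[of x] prob_space.prob_space[OF kernel_prob(1)[OF t], of x]
        prob_space.finite_measure[OF kernel_prob(1)[OF t], of x]
      by (subst Bochner_Integration.integral_add) (auto simp: finite_measure.integrable_const)
    have meanR: "norm (\<integral>y. inner (g y) b \<partial>P t x) \<le> R" for x
      using gb by (intro prob_space.norm_integral_le[OF kernel_prob(1)[OF t]]) auto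
    show 1: "integrable M (\<lambda>\<omega>. inner (h \<omega>) b * inner (g (X t \<omega>)) b)"
      using hb gb K0 by (intro integrable_bounded[of _ "K * R"]) (auto simp: abs_mult intro!: mult_mono)
    show 2: "integrable M (\<lambda>\<omega>. inner (h \<omega>) b * (\<integral>y. inner (g y) b \<partial>P t (X (t - 1) \<omega>)))"
      using hb K0 meanR meas_mean[of "\<lambda>y. inner (g y) b"]
      by (intro integrable_bounded[of _ "K * R"]) (auto simp: abs_mult intro!: mult_mono)
    have 3: "integrable M (\<lambda>\<omega>. inner (h \<omega>) b * R)"
      using hb K0 by (intro integrable_mult_left integrable_bounded[of _ K]) auto
    have "(\<integral>\<omega>. inner (h \<omega>) b * (inner (g (X t \<omega>)) b + R) \<partial>M)
        = (\<integral>\<omega>. inner (h \<omega>) b * (\<integral>y. inner (g y) b + R \<partial>P t (X (t - 1) \<omega>)) \<partial>M)"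
    proof (rule markov_real[OF t])
      show "(\<lambda>\<omega>. inner (h \<omega>) b) \<in> borel_measurable (past M X t)" using h by simp
      show "0 \<le> inner (g x) b + R" "inner (g x) b + R \<le> 2 * R" for x using gb[of x] by linarith+
    qed (use hb in auto)
    then show "?L = ?R" using 1 2 3 by (simp add: mean distrib_left)
  qed
  have "(\<integral>\<omega>. inner (h \<omega>) (g (X t \<omega>)) \<partial>M) = (\<Sum>b\<in>Basis. \<integral>\<omega>. inner (h \<omega>) b * inner (g (X t \<omega>)) b \<partial>M)"
    using int(1) by (subst euclidean_inner) simp
  also have "\<dots> = (\<Sum>b\<in>Basis. \<integral>\<omega>. inner (h \<omega>) b * (\<integral>y. inner (g y) b \<partial>P t (X (t - 1) \<omega>)) \<partial>M)"
    using comp by simp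
  also have "\<dots> = (\<integral>\<omega>. (\<Sum>b\<in>Basis. inner (h \<omega>) b * (\<integral>y. inner (g y) b \<partial>P t (X (t - 1) \<omega>))) \<partial>M)"
    using int(2) by simp
  also have "\<dots> = (\<integral>\<omega>. inner (h \<omega>) (\<integral>y. g y \<partial>P t (X (t - 1) \<omega>)) \<partial>M)"
    by (subst euclidean_inner[of "h _"]) (simp add: intg)
  finally show ?thesis .
qed

end

section \<open>Contraction of kernels with positive curvature\<close>

text \<open>An infinite Wasserstein distance would make the curvature \<open>- \<infinity>\<close>, so the division in the
  definition of the curvature can be undone. That the distance is nonnegative then bounds \<open>\<kappa>\<close>.\<close>

lemma W1_le_of_curvature:
  assumes curv: "ereal \<kappa> \<le> curvature K" and "x \<noteq> y"
  shows "W1 (K x) (K y) \<le> ennreal ((1 - \<kappa>) * dist x y)" and "0 \<le> 1 - \<kappa>"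
proof -
  have d: "dist x y > 0" using \<open>x \<noteq> y\<close> by simp
  have "curvature K \<le> 1 - enn2ereal (W1 (K x) (K y)) / ereal (dist x y)"
    unfolding curvature_def using \<open>x \<noteq> y\<close> by (intro INF_lower2[of "(x, y)"]) auto
  with curv have le: "ereal \<kappa> \<le> 1 - enn2ereal (W1 (K x) (K y)) / ereal (dist x y)"
    by (rule order_trans)
  have "W1 (K x) (K y) \<noteq> top"
  proof
    assume "W1 (K x) (K y) = top"
    then have "ereal \<kappa> \<le> - \<infinity>" using le d by (simp add: ereal_divide one_ereal_def)
    then show False by simp
  qed
  then obtain r where r: "0 \<le> r" "W1 (K x) (K y) = ennreal r"
    by (cases "W1 (K x) (K y)") auto
  have "\<kappa> \<le> 1 - r / dist x y"
    using le r d by (simp add: enn2ereal_ennreal one_ereal_def)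
  then have *: "r \<le> (1 - \<kappa>) * dist x y" using d by (simp add: field_simps)
  then show "W1 (K x) (K y) \<le> ennreal ((1 - \<kappa>) * dist x y)" using r by (simp add: ennreal_leI)
  show "0 \<le> 1 - \<kappa>" using * r(1) d by (metis order_trans zero_le_mult_iff not_le)
qed

context markov_chain
begin

text \<open>For any coupling of \<open>P t x\<close> and \<open>P t y\<close> the difference of the two means is the mean of
  \<open>g (fst z) - g (snd z)\<close>, which is at most \<open>l\<close> times the transport cost. Couplings of nearly
  minimal cost suffice, so an optimal coupling need not exist.\<close>

lemma kernel_contraction:
  fixes g :: "'a \<Rightarrow> complex^'m^'m"
  assumes t: "t \<ge> 1" and curv: "ereal \<kappa> \<le> curvature (P t)"
    and g: "g \<in> borel_measurable borel" and gR: "\<And>x. norm (g x) \<le> R"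
    and lip: "\<And>x y. op_norm (g x - g y) \<le> l * dist x y" and l: "0 \<le> l"
  shows "op_norm ((\<integral>z. g z \<partial>P t x) - (\<integral>z. g z \<partial>P t y)) \<le> (1 - \<kappa>) * l * dist x y"
proof (cases "x = y")
  case False
  note W = W1_le_of_curvature[OF curv False]
  let ?D = "(\<integral>z. g z \<partial>P t x) - (\<integral>z. g z \<partial>P t y)"
  have cost: "op_norm ?D \<le> l * c" if c: "W1 (P t x) (P t y) < ennreal c" and "0 < c" for c
  proof -
    from c obtain \<pi> where \<pi>: "\<pi> \<in> couplings (P t x) (P t y)"
      and int_lt: "(\<integral>\<^sup>+ z. ennreal (dist (fst z) (snd z)) \<partial>\<pi>) < ennreal c"
      unfolding W1_def by (auto simp: INF_less_iff)
    from \<pi> have sets: "sets \<pi> = sets (borel \<Otimes>\<^sub>M borel)"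
      and fst: "distr \<pi> (P t x) fst = P t x" and snd: "distr \<pi> (P t y) snd = P t y"
      unfolding couplings_def using kernel_prob(2)[OF t] by (auto intro: sets_pair_measure_cong)
    have meas: "measurable \<pi> N = borel \<Otimes>\<^sub>M borel \<rightarrow>\<^sub>M N" for N :: "'c measure"
      by (rule measurable_cong_sets[OF sets refl])
    have meas': "measurable N (P t z) = N \<rightarrow>\<^sub>M borel" for N :: "'c measure" and z
      by (rule measurable_cong_sets[OF refl kernel_prob(2)[OF t]])
    have fst_meas: "fst \<in> \<pi> \<rightarrow>\<^sub>M P t x" and snd_meas: "snd \<in> \<pi> \<rightarrow>\<^sub>M P t y"
      unfolding meas' meas by simp_all
    interpret \<pi>: prob_space \<pi>
      by (rule prob_space_distrD[OF fst_meas]) (simp add: fst kernel_prob(1)[OF t])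
    have gm: "g \<in> borel_measurable (P t z)" for z using g by (simp add: kernel_measurable[OF t])
    have gfst: "(\<lambda>z. g (fst z)) \<in> borel_measurable \<pi>" and gsnd: "(\<lambda>z. g (snd z)) \<in> borel_measurable \<pi>"
      using measurable_compose[OF fst_meas gm] measurable_compose[OF snd_meas gm] .
    have int_fst: "integrable \<pi> (\<lambda>z. g (fst z))" and int_snd: "integrable \<pi> (\<lambda>z. g (snd z))"
      using \<pi>.integrable_bounded[OF gfst gR] \<pi>.integrable_bounded[OF gsnd gR] .
    have D: "?D = (\<integral>z. g (fst z) - g (snd z) \<partial>\<pi>)"
      using integral_distr[OF fst_meas gm] integral_distr[OF snd_meas gm] int_fst int_snd
      by (simp add: fst snd)
    have dist_meas: "(\<lambda>z. dist (fst z) (snd z)) \<in> borel_measurable \<pi>"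
      unfolding meas by measurable
    have int_dist: "integrable \<pi> (\<lambda>z. dist (fst z) (snd z))"
      using int_lt by (intro integrableI_bounded dist_meas) (auto intro: order_less_trans)
    have "ennreal (\<integral>z. dist (fst z) (snd z) \<partial>\<pi>) < ennreal c"
      using nn_integral_eq_integral[OF int_dist] int_lt by simp
    then have dist_le: "(\<integral>z. dist (fst z) (snd z) \<partial>\<pi>) \<le> c"
      using \<open>0 < c\<close> by (simp add: ennreal_less_iff)
    show ?thesis
    proof (rule op_norm_leI)
      fix v
      have int_v: "integrable \<pi> (\<lambda>z. (g (fst z) - g (snd z)) *v v)"
        using int_fst int_snd by (intro integrable_bounded_linear[OF mvec.bounded_linear_left]) auto
      have "?D *v v = (\<integral>z. (g (fst z) - g (snd z)) *v v \<partial>\<pi>)"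
        unfolding D using int_fst int_snd
        by (subst integral_bounded_linear[OF mvec.bounded_linear_left]) auto
      also have "norm \<dots> \<le> (\<integral>z. l * norm v * dist (fst z) (snd z) \<partial>\<pi>)"
      proof (rule norm_integral_le_integral[OF int_v])
        show "integrable \<pi> (\<lambda>z. l * norm v * dist (fst z) (snd z))" using int_dist by simp
        show "norm ((g (fst z) - g (snd z)) *v v) \<le> l * norm v * dist (fst z) (snd z)" for z
          using order_trans[OF norm_mult_vec_le_op_norm[of "g (fst z) - g (snd z)" v]
              mult_right_mono[OF lip[of "fst z" "snd z"], of "norm v"]]
          by (simp add: ac_simps)
      qed
      also have "\<dots> = l * norm v * (\<integral>z. dist (fst z) (snd z) \<partial>\<pi>)" by simp
      also have "\<dots> \<le> l * norm v * c" using dist_le l by (intro mult_left_mono) auto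
      finally show "norm (?D *v v) \<le> l * c * norm v" by (simp add: ac_simps)
    qed
  qed
  show ?thesis
  proof (rule field_le_epsilon)
    fix e :: real assume "0 < e"
    define e' where "e' = e / (l + 1)"
    have e': "0 < e'" "l * e' \<le> e" using \<open>0 < e\<close> l by (auto simp: e'_def field_simps)
    have "0 \<le> (1 - \<kappa>) * dist x y" using W(2) by simp
    then have pos: "0 < (1 - \<kappa>) * dist x y + e'" using e'(1) by simp
    have "W1 (P t x) (P t y) < ennreal ((1 - \<kappa>) * dist x y + e')"
      by (rule le_less_trans[OF W(1)]) (use \<open>0 \<le> (1 - \<kappa>) * dist x y\<close> e'(1) in \<open>simp add: ennreal_less_iff\<close>)
    from cost[OF this pos] e'(2)
    show "op_norm ?D \<le> (1 - \<kappa>) * l * dist x y + e" by (simp add: algebra_simps)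
  qed
qed simp

text \<open>\<open>pull j f i x\<close> is the conditional mean of \<open>f (X j)\<close> given \<open>X (j - i) = x\<close>, obtained by
  integrating backwards through the kernels \<open>P j, \<dots>, P (j - i + 1)\<close>.\<close>

primrec pull :: "nat \<Rightarrow> ('a \<Rightarrow> 'b::{banach,second_countable_topology}) \<Rightarrow> nat \<Rightarrow> 'a \<Rightarrow> 'b" where
  "pull j f 0 = f"
| "pull j f (Suc i) = (\<lambda>x. \<integral>y. pull j f i y \<partial>P (j - i) x)"

lemma pull_measurable: "f \<in> borel_measurable borel \<Longrightarrow> i \<le> j \<Longrightarrow> pull j f i \<in> borel_measurable borel"
  by (induction i) (auto intro: kernel_integral_measurable)

lemma norm_pull_le: "(\<And>x. norm (f x) \<le> R) \<Longrightarrow> i \<le> j \<Longrightarrow> norm (pull j f i x) \<le> R"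
proof (induction i arbitrary: x)
  case (Suc i)
  then show ?case
    using prob_space.norm_integral_le[OF kernel_prob(1), of "j - i" "pull j f i" R x] by simp
qed simp

lemma hermitian_pull: "(\<And>x. hermitian (f x)) \<Longrightarrow> hermitian (pull j f i x)"
  by (induction i arbitrary: x) (auto intro: hermitian_integral)

text \<open>Conditioning further back replaces a value by an average of values, and averages of points
  within operator distance \<open>c\<close> of a given matrix stay within that distance.\<close>

lemma pull_osc_le:
  fixes f :: "'a \<Rightarrow> complex^'m^'m"
  assumes f: "f \<in> borel_measurable borel" "\<And>x. norm (f x) \<le> R"
    and osc: "\<And>x y. op_norm (pull j f i x - pull j f i y) \<le> c" and "i + r \<le> j"
  shows "op_norm (pull j f i x - pull j f (i + r) y) \<le> c"
  using \<open>i + r \<le> j\<close>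
proof (induction r arbitrary: y)
  case (Suc r)
  then have t: "1 \<le> j - (i + r)" by simp
  have meas: "pull j f (i + r) \<in> borel_measurable (P (j - (i + r)) y)"
    unfolding kernel_measurable[OF t] using f Suc.prems by (intro pull_measurable) auto
  have "integrable (P (j - (i + r)) y) (pull j f (i + r))"
    by (rule prob_space.integrable_bounded[OF kernel_prob(1)[OF t] meas norm_pull_le])
      (use f Suc.prems in auto)
  from prob_space.op_norm_diff_integral_le[OF kernel_prob(1)[OF t] this, of "pull j f i x" c] Suc
  show ?case by simp
qed (use osc in simp)

lemma pull_osc_total:
  fixes f :: "'a \<Rightarrow> complex^'m^'m"
  assumes f: "f \<in> borel_measurable borel" "\<And>x. norm (f x) \<le> R"
    and osc: "\<And>x y. op_norm (f x - f y) \<le> c"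
  shows "i \<le> j \<Longrightarrow> op_norm (pull j f i x - pull j f i y) \<le> c"
proof (induction i arbitrary: x y)
  case (Suc i)
  then have t: "1 \<le> j - i" by simp
  have meas: "pull j f i \<in> borel_measurable (P (j - i) z)" for z
    unfolding kernel_measurable[OF t] using f Suc.prems by (intro pull_measurable) auto
  have int: "integrable (P (j - i) z) (pull j f i)" for z
    by (rule prob_space.integrable_bounded[OF kernel_prob(1)[OF t] meas norm_pull_le])
      (use f Suc.prems in auto)
  have "op_norm (pull j f i z - pull j f (Suc i) y) \<le> c" for z
    using prob_space.op_norm_diff_integral_le[OF kernel_prob(1)[OF t] int, of "pull j f i z" c y] Suc
    by simp
  then have "op_norm (pull j f (Suc i) y - pull j f i z) \<le> c" for z
    by (subst op_norm_minus_commute)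
  from prob_space.op_norm_diff_integral_le[OF kernel_prob(1)[OF t] int this, of x]
  show ?case by (subst op_norm_minus_commute) simp
qed (use osc in simp)

text \<open>This is where positive curvature enters: every kernel shrinks the Lipschitz constant by the
  factor \<open>1 - \<kappa>\<close>, so that the influence of the present on \<open>f (X j)\<close> decays geometrically.\<close>

lemma pull_lipschitz:
  fixes f :: "'a \<Rightarrow> complex^'m^'m"
  assumes f: "f \<in> borel_measurable borel" "\<And>x. norm (f x) \<le> R"
    and curv: "\<And>t. t \<ge> 1 \<Longrightarrow> ereal \<kappa> \<le> curvature (P t)" and "\<kappa> \<le> 1"
    and lip: "\<And>x y. op_norm (f x - f y) \<le> l * dist x y" and l: "0 \<le> l"
  shows "i \<le> j \<Longrightarrow> op_norm (pull j f i x - pull j f i y) \<le> (1 - \<kappa>) ^ i * l * dist x y"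
proof (induction i arbitrary: x y)
  case (Suc i)
  have "op_norm ((\<integral>z. pull j f i z \<partial>P (j - i) x) - (\<integral>z. pull j f i z \<partial>P (j - i) y))
      \<le> (1 - \<kappa>) * ((1 - \<kappa>) ^ i * l) * dist x y"
    using Suc f l \<open>\<kappa> \<le> 1\<close>
    by (intro kernel_contraction[where R = R] curv pull_measurable norm_pull_le) auto
  then show ?case by (simp add: ac_simps)
qed (use lip in simp)

section \<open>The martingale of block-conditional means\<close>

text \<open>The conditional mean of \<open>f (X j)\<close> given the states \<open>X 0, \<dots>, X (s - 1)\<close>, matching the indexing of
  \<^const>\<open>past\<close>. For \<open>s = 0\<close> nothing is known and it is the unconditional mean. The minimum covers
  \<open>j < s\<close>, where the value \<open>f (X j)\<close> is already determined.\<close>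

definition cond_mean :: "nat \<Rightarrow> ('a \<Rightarrow> 'b::{banach,second_countable_topology}) \<Rightarrow> nat \<Rightarrow> 'w \<Rightarrow> 'b" where
  "cond_mean j f s \<omega> = (case s of 0 \<Rightarrow> (\<integral>\<omega>'. f (X j \<omega>') \<partial>M) | Suc k \<Rightarrow> pull j f (j - k) (X (min j k) \<omega>))"

lemma cond_mean_past:
  assumes "f \<in> borel_measurable borel"
  shows "cond_mean j f s \<in> borel_measurable (past M X s)"
proof (cases s)
  case (Suc k)
  then have "min j k < s" by simp
  from measurable_compose[OF X_past[OF this] pull_measurable[OF assms, of "j - k" j]] Suc
  show ?thesis by (simp add: cond_mean_def[abs_def])
qed (simp add: cond_mean_def[abs_def])

lemma cond_mean_measurable: "f \<in> borel_measurable borel \<Longrightarrow> cond_mean j f s \<in> borel_measurable M"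
  by (rule measurable_from_subalg[OF subalgebra_past cond_mean_past])

lemma norm_cond_mean_le: "(\<And>x. norm (f x) \<le> R) \<Longrightarrow> norm (cond_mean j f s \<omega>) \<le> R"
  by (cases s) (auto simp: cond_mean_def intro!: norm_integral_le norm_pull_le)

lemma past_mono: "s \<le> s' \<Longrightarrow> sets (past M X s) \<subseteq> sets (past M X s')"
  unfolding sets_past by (intro sigma_sets_mono') (blast dest: less_le_trans)

lemma past_measurable_mono:
  assumes "s \<le> s'" "h \<in> past M X s \<rightarrow>\<^sub>M N"
  shows "h \<in> past M X s' \<rightarrow>\<^sub>M N"
  by (rule measurable_from_subalg[OF _ assms(2)])
    (simp add: subalgebra_def space_past past_mono[OF assms(1)])

lemma cond_mean_tower:
  fixes h :: "'w \<Rightarrow> 'c::euclidean_space" and f :: "'a \<Rightarrow> 'c"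
  assumes f: "f \<in> borel_measurable borel" "\<And>x. norm (f x) \<le> R"
    and h: "h \<in> borel_measurable (past M X (Suc k))" "\<And>\<omega>. norm (h \<omega>) \<le> K" and "k \<le> k'"
  shows "(\<integral>\<omega>. inner (h \<omega>) (cond_mean j f (Suc k') \<omega>) \<partial>M)
    = (\<integral>\<omega>. inner (h \<omega>) (cond_mean j f (Suc k) \<omega>) \<partial>M)"
  using \<open>k \<le> k'\<close>
proof (induction k' rule: dec_induct)
  case (step l)
  have "(\<integral>\<omega>. inner (h \<omega>) (cond_mean j f (Suc (Suc l)) \<omega>) \<partial>M)
    = (\<integral>\<omega>. inner (h \<omega>) (cond_mean j f (Suc l) \<omega>) \<partial>M)"
  proof (cases "j \<le> l")
    case False
    then have [simp]: "min j (Suc l) = Suc l" "min j l = l" and j: "j - l = Suc (j - Suc l)" by auto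
    have "h \<in> borel_measurable (past M X (Suc l))"
      by (rule past_measurable_mono[OF _ h(1)]) (use step in simp)
    then have "(\<integral>\<omega>. inner (h \<omega>) (pull j f (j - Suc l) (X (Suc l) \<omega>)) \<partial>M)
      = (\<integral>\<omega>. inner (h \<omega>) (\<integral>y. pull j f (j - Suc l) y \<partial>P (Suc l) (X (Suc l - 1) \<omega>)) \<partial>M)"
      using f by (intro markov_inner[where K = K and R = R] h(2) pull_measurable norm_pull_le) auto
    moreover have "j - (j - Suc l) = Suc l" using False by simp
    ultimately show ?thesis unfolding cond_mean_def by (simp add: j del: diff_Suc_Suc)
  qed (simp add: cond_mean_def min_def)
  with step show ?case by simp
qed simp

lemma integral_pull:
  fixes f :: "'a \<Rightarrow> 'c::euclidean_space"
  assumes f: "f \<in> borel_measurable borel" "\<And>x. norm (f x) \<le> R" and "i \<le> j"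
  shows "integrable M (\<lambda>\<omega>. pull j f i (X (j - i) \<omega>))"
    and "(\<integral>\<omega>. pull j f i (X (j - i) \<omega>) \<partial>M) = (\<integral>\<omega>. f (X j \<omega>) \<partial>M)"
proof -
  have int: "integrable M (\<lambda>\<omega>. pull j f i (X (j - i) \<omega>))" if "i \<le> j" for i
    using f that
    by (intro integrable_bounded[of _ R] norm_pull_le measurable_compose[OF X_measurable pull_measurable]) auto
  then show "integrable M (\<lambda>\<omega>. pull j f i (X (j - i) \<omega>))" using \<open>i \<le> j\<close> .
  show "(\<integral>\<omega>. pull j f i (X (j - i) \<omega>) \<partial>M) = (\<integral>\<omega>. f (X j \<omega>) \<partial>M)"
  proof (rule euclidean_eqI)
    fix b :: 'c
    have "(\<integral>\<omega>. inner b (cond_mean j f (Suc j) \<omega>) \<partial>M) = (\<integral>\<omega>. inner b (cond_mean j f (Suc (j - i)) \<omega>) \<partial>M)"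
      by (rule cond_mean_tower[where K = "norm b", OF f]) auto
    then have "inner b (\<integral>\<omega>. pull j f i (X (j - i) \<omega>) \<partial>M) = inner b (\<integral>\<omega>. f (X j \<omega>) \<partial>M)"
      using int[of i] int[of 0] \<open>i \<le> j\<close> by (simp add: cond_mean_def min_absorb2)
    then show "inner (\<integral>\<omega>. pull j f i (X (j - i) \<omega>) \<partial>M) b = inner (\<integral>\<omega>. f (X j \<omega>) \<partial>M) b"
      by (simp add: inner_commute)
  qed
qed

text \<open>The later conditional mean is a value of \<open>pull j f (j - k')\<close> and the earlier one an average of such
  values; hence their distance is at most the oscillation of that function.\<close>

lemma cond_mean_step_le:
  fixes f :: "'a \<Rightarrow> complex^'m^'m"
  assumes f: "f \<in> borel_measurable borel" "\<And>x. norm (f x) \<le> R"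
    and osc: "\<And>x y. op_norm (pull j f (j - k') x - pull j f (j - k') y) \<le> c"
    and s: "s = 0 \<or> (\<exists>k\<le>k'. s = Suc k)"
  shows "op_norm (cond_mean j f (Suc k') \<omega> - cond_mean j f s \<omega>) \<le> c"
  using s
proof
  assume "s = 0"
  have "op_norm (cond_mean j f (Suc k') \<omega> - (\<integral>\<omega>'. pull j f (j - k') (X (j - (j - k')) \<omega>') \<partial>M)) \<le> c"
    by (rule op_norm_diff_integral_le) (use f integral_pull(1)[OF f] osc in \<open>auto simp: cond_mean_def\<close>)
  then show ?thesis using integral_pull(2)[OF f, of "j - k'" j] \<open>s = 0\<close> by (simp add: cond_mean_def[of j f 0])
next
  assume "\<exists>k\<le>k'. s = Suc k"
  then obtain k where k: "k \<le> k'" "s = Suc k" by blast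
  have "j - k = (j - k') + ((j - k) - (j - k'))" "(j - k') + ((j - k) - (j - k')) \<le> j" using k by auto
  then show ?thesis
    using pull_osc_le[OF f osc, of "(j - k) - (j - k')"] k by (simp add: cond_mean_def)
qed

end

section \<open>Length and number of the blocks\<close>

text \<open>The left-hand side bounds one increment of the block martingale: observations up to time \<open>a\<close> are
  already known, and an observation at time \<open>j\<close> beyond the end \<open>a + l\<close> of the block depends on the block
  only through a factor \<open>r ^ (j - (a + l))\<close>. The block itself and the block after it contribute \<open>\<Delta>\<close>
  per observation; later observations form a geometric series, which the assumption on \<open>l\<close> makes at most
  as large as the contribution of one more block.\<close>

lemma block_increment_bound:
  fixes r E \<Delta> :: real
  assumes r: "0 \<le> r" "r < 1" and "0 \<le> E" "0 \<le> \<Delta>"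
    and mix: "r ^ l * E / (1 - r) \<le> l * \<Delta>"
  shows "(\<Sum>j=1..n. if j \<le> a then 0 else min \<Delta> (r ^ (j - (a + l)) * E)) \<le> real (min n (3 * l)) * \<Delta>"
    (is "?S \<le> _")
proof -
  have "?S \<le> (\<Sum>j=1..n. \<Delta>)" using assms by (intro sum_mono) auto
  then have trivial: "?S \<le> real n * \<Delta>" by simp
  define U where "U = {j. a + 2 * l < j \<and> j \<le> n}"
  have "?S \<le> (\<Sum>j=1..n. (if a < j \<and> j \<le> a + 2 * l then \<Delta> else 0)
      + (if j \<in> U then r ^ l * E * r ^ (j - (a + 2 * l)) else 0))"
  proof (intro sum_mono)
    fix j assume j: "j \<in> {1..n}"
    show "(if j \<le> a then 0 else min \<Delta> (r ^ (j - (a + l)) * E))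
        \<le> (if a < j \<and> j \<le> a + 2 * l then \<Delta> else 0) + (if j \<in> U then r ^ l * E * r ^ (j - (a + 2 * l)) else 0)"
    proof (cases "a + 2 * l < j")
      case True
      then have "j - (a + l) = l + (j - (a + 2 * l))" by simp
      then have eq: "r ^ (j - (a + l)) * E = r ^ l * E * r ^ (j - (a + 2 * l))" by (simp add: power_add)
      show ?thesis using True j unfolding eq by (simp add: U_def)
    qed (auto simp: U_def)
  qed
  also have "\<dots> = (\<Sum>j\<in>{1..n} \<inter> {j. a < j \<and> j \<le> a + 2 * l}. \<Delta>)
      + (\<Sum>j\<in>{1..n} \<inter> U. r ^ l * E * r ^ (j - (a + 2 * l)))"
    by (simp only: sum.distrib sum.inter_restrict finite_atLeastAtMost mem_Collect_eq)
  also have "\<dots> \<le> real (2 * l) * \<Delta> + r ^ l * E / (1 - r)"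
  proof (rule add_mono)
    have "card ({1..n} \<inter> {j. a < j \<and> j \<le> a + 2 * l}) \<le> card {a<..a + 2 * l}"
      by (intro card_mono) auto
    then show "(\<Sum>j\<in>{1..n} \<inter> {j. a < j \<and> j \<le> a + 2 * l}. \<Delta>) \<le> real (2 * l) * \<Delta>"
      using \<open>0 \<le> \<Delta>\<close> by (auto intro!: mult_right_mono simp flip: of_nat_mult)
    have "(\<Sum>j\<in>{1..n} \<inter> U. r ^ (j - (a + 2 * l))) = (\<Sum>i\<in>(\<lambda>j. j - (a + 2 * l)) ` ({1..n} \<inter> U). r ^ i)"
      by (subst sum.reindex) (auto simp: inj_on_def U_def)
    also have "\<dots> \<le> (\<Sum>i<Suc n. r ^ i)"
      using r by (intro sum_mono2) auto
    also have "\<dots> = (1 - r ^ Suc n) / (1 - r)" using r by (subst sum_gp_strict) auto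
    also have "\<dots> \<le> 1 / (1 - r)" using r by (intro divide_right_mono) auto
    finally have "r ^ l * E * (\<Sum>j\<in>{1..n} \<inter> U. r ^ (j - (a + 2 * l))) \<le> r ^ l * E * (1 / (1 - r))"
      using r \<open>0 \<le> E\<close> by (intro mult_left_mono) auto
    then show "(\<Sum>j\<in>{1..n} \<inter> U. r ^ l * E * r ^ (j - (a + 2 * l))) \<le> r ^ l * E / (1 - r)"
      by (simp add: sum_distrib_left)
  qed
  also have "\<dots> \<le> real (3 * l) * \<Delta>" using mix by (simp add: mult.commute)
  finally have "?S \<le> real (3 * l) * \<Delta>" .
  with trivial show ?thesis by (simp add: min_def)
qed

text \<open>The block length is \<open>K\<close> rounded up: the relaxation time \<open>1 / \<kappa>\<close> times the logarithmic factor
  that brings the a priori bound \<open>E\<close> on the oscillation down to \<open>\<Delta>\<close>.\<close>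

lemma block_length:
  fixes \<kappa> E \<Delta> :: real
  assumes \<kappa>: "0 < \<kappa>" "\<kappa> \<le> 1" and \<Delta>: "0 < \<Delta>" "\<Delta> \<le> E"
  defines "K \<equiv> inverse \<kappa> * (1 + ln (E / \<Delta>))"
  obtains l :: nat where "l \<ge> 1" "real l \<le> 2 * K" "(1 - \<kappa>) ^ l * E / \<kappa> \<le> l * \<Delta>"
proof -
  have ln: "0 \<le> ln (E / \<Delta>)" using \<Delta> by simp
  have "1 \<le> inverse \<kappa>" using \<kappa> by (simp add: one_le_inverse)
  then have "1 * 1 \<le> K" unfolding K_def using ln \<kappa> by (intro mult_mono) auto
  then have K: "1 \<le> K" by simp
  define l where "l = nat \<lceil>K\<rceil>"
  have l: "K \<le> real l" "real l \<le> K + 1" using K by (simp_all add: l_def)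
  have "1 + ln (E / \<Delta>) = \<kappa> * K" using \<kappa> by (simp add: K_def)
  also have "\<dots> \<le> \<kappa> * l" using l(1) \<kappa> by (intro mult_left_mono) auto
  finally have \<kappa>l: "1 + ln (E / \<Delta>) \<le> \<kappa> * l" .
  have "(1 - \<kappa>) ^ l \<le> exp (- \<kappa>) ^ l"
    using \<kappa> exp_ge_add_one_self[of "- \<kappa>"] by (intro power_mono) auto
  also have "\<dots> = exp (- (\<kappa> * l))" by (simp add: exp_of_nat_mult[symmetric] mult.commute)
  also have "\<dots> \<le> exp (- ln (E / \<Delta>))" using \<kappa>l by simp
  also have "\<dots> = \<Delta> / E" using \<Delta> by (simp add: exp_minus)
  finally have "(1 - \<kappa>) ^ l * E \<le> \<Delta>" using \<Delta> by (simp add: field_simps)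
  then have "(1 - \<kappa>) ^ l * E / \<kappa> \<le> \<Delta> / \<kappa>" using \<kappa> by (simp add: divide_right_mono)
  also have "\<dots> \<le> l * \<Delta>"
  proof -
    have "1 \<le> \<kappa> * l" using \<kappa>l ln by simp
    then have "\<Delta> * 1 \<le> \<Delta> * (\<kappa> * l)" using \<Delta> by (intro mult_left_mono) auto
    then show ?thesis using \<kappa> by (simp add: pos_divide_le_eq ac_simps)
  qed
  finally have "(1 - \<kappa>) ^ l * E / \<kappa> \<le> l * \<Delta>" .
  moreover have "1 \<le> l" using l(1) K by linarith
  moreover have "real l \<le> 2 * K" using l(2) K by linarith
  ultimately show thesis using that by blast
qed

text \<open>If \<open>n \<le> l\<close> a single block suffices and its increment is at most \<open>n\<close> observations long; otherwise
  about \<open>n / l\<close> blocks with increments of at most three block lengths are needed. Either way the total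
  squared increment is of order \<open>n l\<close>, rather than the \<open>n l\<^sup>2\<close> that increments of single steps would
  give.\<close>

lemma block_count:
  fixes n l :: nat
  assumes "n \<ge> 1" "l \<ge> 1"
  obtains B where "B \<ge> 1" "n \<le> B * l" "real B * (real (min n (3 * l)))\<^sup>2 \<le> 18 * real n * real l"
proof (cases "n \<le> l")
  case True
  have "real 1 * (real (min n (3 * l)))\<^sup>2 \<le> real n * real l"
    using True assms by (auto simp: min_def power2_eq_square intro!: mult_left_mono)
  also have "\<dots> \<le> 18 * real n * real l" by simp
  finally show ?thesis using True by (intro that[of 1]) auto
next
  case False
  define B where "B = Suc (n div l)"
  have "n mod l < l" using assms by simp
  then have "n div l * l + n mod l \<le> B * l"
    unfolding B_def mult_Suc by linarith
  then have "n \<le> B * l" by (simp only: div_mult_mod_eq)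
  have "B * l \<le> 2 * n"
    using False div_times_less_eq_dividend[of n l] unfolding B_def mult_Suc by linarith
  then have "real B * real l \<le> 2 * real n" by (metis of_nat_mono of_nat_mult of_nat_numeral)
  then have Bl: "real B * real l * (9 * real l) \<le> 2 * real n * (9 * real l)"
    by (intro mult_right_mono) auto
  have "(real (min n (3 * l)))\<^sup>2 \<le> (3 * real l)\<^sup>2" by (intro power_mono) auto
  then have "real B * (real (min n (3 * l)))\<^sup>2 \<le> real B * (3 * real l)\<^sup>2"
    by (intro mult_left_mono) auto
  also have "\<dots> = real B * real l * (9 * real l)" by (simp add: power2_eq_square)
  also note Bl
  finally have "real B * (real (min n (3 * l)))\<^sup>2 \<le> 18 * real n * real l" by simp
  with \<open>n \<le> B * l\<close> show ?thesis by (intro that[of B]) (auto simp: B_def)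
qed

section \<open>Observables with bounded operator oscillation\<close>

lemma op_norm_le_Lip:
  fixes f :: "'a::metric_space \<Rightarrow> complex^'m^'m"
  assumes "Lip_op f \<le> ennreal L" "0 \<le> L"
  shows "op_norm (f x - f y) \<le> L * dist x y"
proof (cases "x = y")
  case False
  have "ennreal (op_norm (f x - f y) / dist x y) \<le> Lip_op f"
    unfolding Lip_op_def using False by (intro SUP_upper2[of "(x, y)"]) auto
  then have "op_norm (f x - f y) / dist x y \<le> L"
    using assms order_trans by (subst ennreal_le_iff[symmetric]) blast+
  then show ?thesis using False by (simp add: pos_divide_le_eq)
qed simp

lemma op_norm_le_Delta:
  fixes F :: "nat \<Rightarrow> 'a \<Rightarrow> complex^'m^'m"
  assumes "0 < enn2real (Delta_op F)" "t \<ge> 1"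
  shows "op_norm (F t x - F t y) \<le> enn2real (Delta_op F)"
proof -
  have "Delta_op F < top" using assms(1) by (metis enn2real_top less_irrefl top.not_eq_extremum)
  moreover have "ennreal (op_norm (F t x - F t y)) \<le> Delta_op F"
    unfolding Delta_op_def using assms(2) by (intro SUP_upper2[of t] SUP_upper2[of x] SUP_upper2[of y]) auto
  ultimately show ?thesis
    using enn2real_mono[of "ennreal (op_norm (F t x - F t y))" "Delta_op F"] by (simp add: op_norm_nonneg)
qed

lemma borel_measurable_of_op_lipschitz:
  fixes f :: "'a::{metric_space} \<Rightarrow> complex^'m^'m"
  assumes lip: "\<And>x y. op_norm (f x - f y) \<le> L * dist x y"
  shows "f \<in> borel_measurable borel"
proof (rule borel_measurable_continuous_onI)
  let ?c = "norm (mat 1 :: complex^'m^'m)"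
  have "(\<bar>L\<bar> * ?c)-lipschitz_on UNIV f"
  proof (rule lipschitz_onI)
    fix x y :: 'a
    have "L * dist x y \<le> \<bar>L\<bar> * dist x y" by (intro mult_right_mono) auto
    with lip[of x y] have "op_norm (f x - f y) \<le> \<bar>L\<bar> * dist x y" by (rule order_trans)
    then have "op_norm (f x - f y) * ?c \<le> \<bar>L\<bar> * dist x y * ?c" by (rule mult_right_mono) simp
    with norm_le_op_norm[of "f x - f y"] show "dist (f x) (f y) \<le> \<bar>L\<bar> * ?c * dist x y"
      by (simp add: dist_norm ac_simps)
  qed simp
  then show "continuous_on UNIV f" by (rule lipschitz_on_continuous_on)
qed

lemma bounded_of_op_osc:
  fixes f :: "'a \<Rightarrow> complex^'m^'m"
  assumes "\<And>x y. op_norm (f x - f y) \<le> c"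
  shows "norm (f x) \<le> norm (f a) + c * norm (mat 1 :: complex^'m^'m)"
  using norm_triangle_ineq[of "f a" "f x - f a"] norm_le_op_norm[of "f x - f a"]
    mult_right_mono[OF assms[of x a], of "norm (mat 1 :: complex^'m^'m)"]
  by simp

section \<open>Concentration of the sum of observations\<close>

context markov_chain
begin

text \<open>The block martingale \<open>W b\<close> is the conditional mean of the centred sum given the states up to time
  \<open>b l\<close>. It starts at \<open>0\<close>, before even the initial state is revealed, and equals the centred sum once
  \<open>b l \<ge> n\<close>.\<close>

lemma lambda_max_sum_tail:
  fixes F :: "nat \<Rightarrow> 'a \<Rightarrow> complex^'m^'m"
  assumes herm: "\<And>t x. t \<ge> 1 \<Longrightarrow> hermitian (F t x)"
    and lip: "\<And>t x y. t \<ge> 1 \<Longrightarrow> op_norm (F t x - F t y) \<le> L * dist x y" and "0 \<le> L"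
    and osc: "\<And>t x y. t \<ge> 1 \<Longrightarrow> op_norm (F t x - F t y) \<le> \<Delta>" and "0 < \<Delta>"
    and diam: "\<And>x y :: 'a. dist x y \<le> D" and "0 \<le> D"
    and curv: "\<And>t. t \<ge> 1 \<Longrightarrow> ereal \<kappa> \<le> curvature (P t)" and \<kappa>: "0 < \<kappa>" "\<kappa> \<le> 1"
    and mix: "(1 - \<kappa>) ^ l * (L * D) / \<kappa> \<le> l * \<Delta>" and "l \<ge> 1" "n \<ge> 1"
    and B: "n \<le> B * l" "B \<ge> 1" and "s > 0"
  defines "C \<equiv> real (min n (3 * l)) * \<Delta>"
  shows "measure M {\<omega> \<in> space M. s \<le> lambda_max (\<Sum>j=1..n. F j (X j \<omega>) - (\<integral>\<omega>'. F j (X j \<omega>') \<partial>M))}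
    \<le> real CARD('m) * exp (- (s\<^sup>2 / (2 * real B * C\<^sup>2)))"
proof -
  \<comment> \<open>an arbitrary base point, used only to bound the observables\<close>
  define a :: "'a" where "a = undefined"
  define R where "R j = norm (F j a) + \<Delta> * norm (mat 1 :: complex^'m^'m)" for j
  have meas: "F j \<in> borel_measurable borel" if "j \<ge> 1" for j
    using borel_measurable_of_op_lipschitz[OF lip[OF that]] .
  have FR: "norm (F j x) \<le> R j" if "j \<ge> 1" for j x
    unfolding R_def by (rule bounded_of_op_osc[OF osc[OF that]])
  define \<tau> where "\<tau> b = (case b of 0 \<Rightarrow> 0 | Suc b' \<Rightarrow> Suc (b * l))" for b :: nat
  define E where "E j = (\<integral>\<omega>. F j (X j \<omega>) \<partial>M)" for j
  define W where "W b \<omega> = (\<Sum>j=1..n. cond_mean j (F j) (\<tau> b) \<omega> - E j)" for b \<omega>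
  have W_past: "W b \<in> borel_measurable (past M X (\<tau> b))" for b
    unfolding W_def[abs_def]
    by (intro borel_measurable_sum borel_measurable_diff cond_mean_past meas) auto
  have W_meas: "W b \<in> borel_measurable M" for b
    by (rule measurable_from_subalg[OF subalgebra_past W_past])
  have herm_E: "hermitian (E j)" if "j \<ge> 1" for j
    unfolding E_def by (intro hermitian_integral herm that)
  have W_diff: "W (Suc b) \<omega> - W b \<omega> = (\<Sum>j=1..n. cond_mean j (F j) (\<tau> (Suc b)) \<omega> - cond_mean j (F j) (\<tau> b) \<omega>)"
    for b \<omega>
    by (simp add: W_def sum_subtractf[symmetric])
  have W_0: "W 0 \<omega> = 0" for \<omega> by (simp add: W_def \<tau>_def cond_mean_def E_def)
  have step: "op_norm (W (Suc b) \<omega> - W b \<omega>) \<le> C" for b \<omega>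
  proof -
    define k' where "k' = b * l + l"
    have \<tau>': "\<tau> (Suc b) = Suc k'" by (simp add: \<tau>_def k'_def)
    have \<tau>: "\<tau> b = 0 \<or> (\<exists>k\<le>k'. \<tau> b = Suc k)" by (cases b) (auto simp: \<tau>_def k'_def)
    have "op_norm (cond_mean j (F j) (Suc k') \<omega> - cond_mean j (F j) (\<tau> b) \<omega>)
        \<le> (if j \<le> b * l then 0 else min \<Delta> ((1 - \<kappa>) ^ (j - (b * l + l)) * (L * D)))" if j: "j \<in> {1..n}" for j
    proof (cases "j \<le> b * l")
      case True
      then obtain b' where "b = Suc b'" using j by (cases b) auto
      then show ?thesis using True by (simp add: cond_mean_def \<tau>_def k'_def min_def)
    next
      case False
      have j1: "j \<ge> 1" using j by simp
      have "op_norm (pull j (F j) (j - k') x - pull j (F j) (j - k') y)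
          \<le> min \<Delta> ((1 - \<kappa>) ^ (j - k') * (L * D))" for x y
      proof (rule min.boundedI)
        show "op_norm (pull j (F j) (j - k') x - pull j (F j) (j - k') y) \<le> \<Delta>"
          by (rule pull_osc_total[OF meas[OF j1] FR[OF j1] osc[OF j1]]) simp
        have "op_norm (pull j (F j) (j - k') x - pull j (F j) (j - k') y) \<le> (1 - \<kappa>) ^ (j - k') * L * dist x y"
          by (rule pull_lipschitz[OF meas[OF j1] FR[OF j1] curv \<kappa>(2) lip[OF j1] \<open>0 \<le> L\<close>]) simp_all
        also have "\<dots> \<le> (1 - \<kappa>) ^ (j - k') * L * D"
          using \<kappa> \<open>0 \<le> L\<close> diam[of x y] by (intro mult_left_mono) auto
        finally show "op_norm (pull j (F j) (j - k') x - pull j (F j) (j - k') y)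
            \<le> (1 - \<kappa>) ^ (j - k') * (L * D)" by (simp add: ac_simps)
      qed
      from cond_mean_step_le[OF meas[OF j1] FR[OF j1] this \<tau>] False show ?thesis by (simp add: k'_def)
    qed
    then have "op_norm (W (Suc b) \<omega> - W b \<omega>)
        \<le> (\<Sum>j=1..n. if j \<le> b * l then 0 else min \<Delta> ((1 - \<kappa>) ^ (j - (b * l + l)) * (L * D)))"
      unfolding W_diff \<tau>' by (intro order_trans[OF op_norm_sum_le] sum_mono)
    also have "\<dots> \<le> C"
      unfolding C_def using \<kappa> \<open>0 \<le> L\<close> \<open>0 \<le> D\<close> \<open>0 < \<Delta>\<close> mix by (intro block_increment_bound) auto
    finally show ?thesis .
  qed
  have C_pos: "C > 0" using \<open>l \<ge> 1\<close> \<open>n \<ge> 1\<close> \<open>0 < \<Delta>\<close> by (simp add: C_def)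
  have W_bounded: "\<exists>R. \<forall>\<omega>. norm (W b \<omega>) \<le> R" for b
  proof -
    have "norm (W b \<omega>) \<le> (\<Sum>j=1..n. R j + norm (E j))" for \<omega>
      unfolding W_def using FR
      by (intro order_trans[OF norm_sum] sum_mono order_trans[OF norm_triangle_ineq4] add_mono norm_cond_mean_le) auto
    then show ?thesis by blast
  qed
  have martingale: "(\<integral>\<omega>. inner (\<phi> (W b \<omega>)) (W (Suc b) \<omega> - W b \<omega>) \<partial>M) = 0"
    if \<phi>: "continuous_on UNIV \<phi>" for b and \<phi> :: "complex^'m^'m \<Rightarrow> complex^'m^'m"
  proof -
    obtain R' where "\<And>\<omega>. norm (W b \<omega>) \<le> R'" using W_bounded by blast
    then obtain K where K: "\<And>\<omega>. norm (\<phi> (W b \<omega>)) \<le> K"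
      using bounded_continuous_compose[OF \<phi>] by blast
    have h_past: "(\<lambda>\<omega>. \<phi> (W b \<omega>)) \<in> borel_measurable (past M X (\<tau> b))"
      by (rule measurable_compose[OF W_past borel_measurable_continuous_onI[OF \<phi>]])
    then have h_meas: "(\<lambda>\<omega>. \<phi> (W b \<omega>)) \<in> borel_measurable M"
      by (rule measurable_from_subalg[OF subalgebra_past])
    have int: "integrable M (\<lambda>\<omega>. inner (\<phi> (W b \<omega>)) (cond_mean j (F j) u \<omega>))" if "j \<ge> 1" for j u
      by (rule integrable_inner_bounded[OF h_meas cond_mean_measurable[OF meas[OF that]] K
            norm_cond_mean_le[OF FR[OF that]]])
    have "(\<integral>\<omega>. inner (\<phi> (W b \<omega>)) (cond_mean j (F j) (\<tau> (Suc b)) \<omega>) \<partial>M)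
        = (\<integral>\<omega>. inner (\<phi> (W b \<omega>)) (cond_mean j (F j) (\<tau> b) \<omega>) \<partial>M)" if j: "j \<ge> 1" for j
    \<comment> \<open>For \<open>b = 0\<close> the test function is constant and the claim is that the first conditional mean is unbiased.\<close>
    proof (cases b)
      case 0
      have int_c: "integrable M (\<lambda>\<omega>. cond_mean j (F j) l' \<omega>)" for l'
        by (rule integrable_bounded[OF cond_mean_measurable[OF meas[OF j]] norm_cond_mean_le[OF FR[OF j]]])
      have "j - (j - l) = min j l" by simp
      then have "(\<integral>\<omega>. cond_mean j (F j) (Suc l) \<omega> \<partial>M) = E j"
        using integral_pull(2)[OF meas[OF j] FR[OF j], of "j - l" j]
        by (simp add: cond_mean_def E_def)
      moreover have "cond_mean j (F j) 0 \<omega> = E j" for \<omega> by (simp add: cond_mean_def E_def)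
      ultimately show ?thesis using 0 int_c by (simp add: W_0 \<tau>_def prob_space)
    next
      case (Suc b')
      then have \<tau>: "\<tau> b = Suc (b * l)" "\<tau> (Suc b) = Suc (Suc b * l)" by (simp_all add: \<tau>_def)
      show ?thesis
        unfolding \<tau>(2) unfolding \<tau>(1)
        by (rule cond_mean_tower[OF meas[OF j] FR[OF j] h_past[unfolded \<tau>(1)] K]) simp
    qed
    then have "(\<integral>\<omega>. (\<Sum>j=1..n. inner (\<phi> (W b \<omega>)) (cond_mean j (F j) (\<tau> (Suc b)) \<omega>)
        - inner (\<phi> (W b \<omega>)) (cond_mean j (F j) (\<tau> b) \<omega>)) \<partial>M) = 0"
      using int by (subst Bochner_Integration.integral_sum) auto
    then show ?thesis by (simp add: W_diff inner_sum_right inner_diff_right)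
  qed
  interpret hermitian_martingale M W C
  proof unfold_locales
    show "hermitian (W b \<omega>)" for b \<omega>
    proof -
      have "hermitian (cond_mean j (F j) u \<omega>)" if "j \<ge> 1" for j u
        using herm[OF that] by (cases u) (auto simp: cond_mean_def intro!: hermitian_integral hermitian_pull)
      then show ?thesis unfolding W_def by (intro hermitian_sum hermitian_diff herm_E) auto
    qed
    show "norm ((W (Suc b) \<omega> - W b \<omega>) *v v) \<le> C * norm v" for b \<omega> v
      by (rule order_trans[OF norm_mult_vec_le_op_norm mult_right_mono[OF step]]) simp
  qed (use W_meas W_0 martingale C_pos in auto)
  have "W B \<omega> = (\<Sum>j=1..n. F j (X j \<omega>) - (\<integral>\<omega>'. F j (X j \<omega>') \<partial>M))" for \<omega>
    unfolding W_def
  proof (intro sum.cong refl)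
    fix j assume "j \<in> {1..n}"
    then have "j \<le> B * l" using B by simp
    moreover have "\<tau> B = Suc (B * l)" using B by (cases B) (simp_all add: \<tau>_def)
    ultimately show "cond_mean j (F j) (\<tau> B) \<omega> - E j = F j (X j \<omega>) - (\<integral>\<omega>'. F j (X j \<omega>') \<partial>M)"
      by (simp add: cond_mean_def E_def min_absorb1)
  qed
  with lambda_max_tail[of B s] B \<open>s > 0\<close> show ?thesis by simp
qed

end

theorem theorem8:
  fixes M :: "'w measure"
    and \<mu>0 :: "'a::polish_space measure"
    and P :: "nat \<Rightarrow> 'a \<Rightarrow> 'a measure"
    and X :: "nat \<Rightarrow> 'w \<Rightarrow> 'a"
    and F :: "nat \<Rightarrow> 'a \<Rightarrow> complex ^ 'm ^ 'm"
    and D L \<kappa> \<Delta> v2 \<epsilon> :: real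
    and n :: nat
  assumes chain: "markov_chain M \<mu>0 P X"
    and herm: "\<And>t x. t \<ge> 1 \<Longrightarrow> hermitian (F t x)"
    and bdd: "bounded (UNIV :: 'a set)"
    and D_eq: "D = diameter (UNIV :: 'a set)"
    and L_pos: "L > 0"
    and Lip: "\<And>t. t \<ge> 1 \<Longrightarrow> Lip_op (F t) \<le> ennreal L"
    and kappa_pos: "\<kappa> > 0"
    and curv: "\<And>t. t \<ge> 1 \<Longrightarrow> curvature (P t) \<ge> ereal \<kappa>"
    and Delta_eq: "\<Delta> = enn2real (Delta_op F)"
    and Delta_range: "\<Delta> \<in> {0<..L * D}"
    and v2_eq: "v2 = 3200 / pi\<^sup>2 * \<Delta>\<^sup>2 * inverse \<kappa> * (1 + ln (L * D / \<Delta>))"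
    and n: "n \<ge> 1"
    and eps: "\<epsilon> > 0"
  shows "\<P>(\<omega> in M. lambda_max (\<Sum>j=1..n. F j (X j \<omega>) - (\<integral>\<omega>'. F j (X j \<omega>') \<partial>M)) \<ge> real n * \<epsilon>)
    \<le> real CARD('m) powr (2 - pi / 4) * exp (- (real n * \<epsilon>\<^sup>2) / (2 * v2))"
proof -
  interpret markov_chain M \<mu>0 P X by (rule chain)
  have \<Delta>: "0 < \<Delta>" "\<Delta> \<le> L * D" using Delta_range by auto
  then have "0 < L * D" by linarith
  then have "0 < D" using L_pos by (simp add: zero_less_mult_iff)
  have diam: "dist x y \<le> D" for x y :: 'a
    unfolding D_eq by (rule diameter_bounded_bound[OF bdd]) auto
  have "\<exists>x y :: 'a. x \<noteq> y"
  proof (rule ccontr)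
    assume "\<nexists>x y :: 'a. x \<noteq> y"
    then have "(UNIV :: 'a set) = {undefined}" by auto
    then have "diameter (UNIV :: 'a set) = 0" by (metis diameter_singleton)
    then show False using \<open>0 < D\<close> D_eq by simp
  qed
  then obtain x y :: 'a where "x \<noteq> y" by blast
  from W1_le_of_curvature(2)[OF curv[of 1] this] have \<kappa>1: "\<kappa> \<le> 1" by simp
  define K where "K = inverse \<kappa> * (1 + ln (L * D / \<Delta>))"
  obtain l where l: "l \<ge> 1" "real l \<le> 2 * K" "(1 - \<kappa>) ^ l * (L * D) / \<kappa> \<le> l * \<Delta>"
    using block_length[OF kappa_pos \<kappa>1 \<Delta>] unfolding K_def by metis
  obtain B where B: "B \<ge> 1" "n \<le> B * l"
    and B_le: "real B * (real (min n (3 * l)))\<^sup>2 \<le> 18 * real n * real l"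
    using block_count[OF n l(1)] by metis
  define C where "C = real (min n (3 * l)) * \<Delta>"
  let ?A = "{\<omega> \<in> space M. real n * \<epsilon> \<le> lambda_max (\<Sum>j=1..n. F j (X j \<omega>) - (\<integral>\<omega>'. F j (X j \<omega>') \<partial>M))}"
  have "measure M ?A \<le> real CARD('m) * exp (- ((real n * \<epsilon>)\<^sup>2 / (2 * real B * C\<^sup>2)))"
    unfolding C_def
  proof (rule lambda_max_sum_tail[OF herm _ _ _ \<Delta>(1) diam _ curv kappa_pos \<kappa>1 l(3,1) n B(2,1)])
    show "op_norm (F t x - F t y) \<le> L * dist x y" if "t \<ge> 1" for t x y
      using op_norm_le_Lip[OF Lip[OF that]] L_pos by simp
    show "op_norm (F t x - F t y) \<le> \<Delta>" if "t \<ge> 1" for t x y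
      using op_norm_le_Delta[of F t x y] \<Delta>(1) that unfolding Delta_eq by simp
  qed (use L_pos \<open>0 < D\<close> n eps in auto)
  also have "\<dots> \<le> real CARD('m) powr (2 - pi / 4) * exp (- (real n * \<epsilon>\<^sup>2) / (2 * v2))"
  proof (rule mult_mono)
    have "1 \<le> real CARD('m)" using zero_less_card_finite[where 'a='m] by linarith
    then have "real CARD('m) powr 1 \<le> real CARD('m) powr (2 - pi / 4)"
      using pi_less_4 by (intro powr_mono) auto
    then show "real CARD('m) \<le> real CARD('m) powr (2 - pi / 4)" by simp
    have "real l \<ge> 1" using l(1) by simp
    then have K: "K > 0" using l(2) by linarith
    have "real B * C\<^sup>2 = real B * (real (min n (3 * l)))\<^sup>2 * \<Delta>\<^sup>2"
      by (simp add: C_def power_mult_distrib)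
    also have "\<dots> \<le> 18 * real n * real l * \<Delta>\<^sup>2" by (intro mult_right_mono B_le) simp
    also have "\<dots> \<le> 18 * real n * (2 * K) * \<Delta>\<^sup>2"
      by (intro mult_right_mono mult_left_mono l(2)) auto
    also have "\<dots> = real n * (36 * (\<Delta>\<^sup>2 * K))" by simp
    also have "\<dots> \<le> real n * v2"
    proof (intro mult_left_mono)
      \<comment> \<open>The bound \<open>pi < 4\<close> leaves \<open>3200 / pi\<^sup>2 \<ge> 200\<close>, well above the constant \<open>36\<close> of the argument.\<close>
      have "pi\<^sup>2 \<le> 4\<^sup>2" using pi_less_4 pi_gt_zero by (intro power_mono) auto
      then have "36 \<le> 3200 / pi\<^sup>2" using pi_gt_zero by (simp add: pos_le_divide_eq)
      then have "36 * (\<Delta>\<^sup>2 * K) \<le> 3200 / pi\<^sup>2 * (\<Delta>\<^sup>2 * K)"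
        using K by (intro mult_right_mono) auto
      then show "36 * (\<Delta>\<^sup>2 * K) \<le> v2" by (simp add: v2_eq K_def ac_simps)
    qed simp
    finally have BC: "real B * C\<^sup>2 \<le> real n * v2" .
    have pos: "0 < real B * C\<^sup>2" using B(1) l(1) n \<Delta>(1) by (auto simp: C_def)
    then have v2: "0 < v2" using BC n by (metis less_le_trans of_nat_0_le_iff zero_less_mult_iff not_le)
    have "real n * \<epsilon>\<^sup>2 / (2 * v2) = (real n * \<epsilon>)\<^sup>2 / (2 * (real n * v2))"
      using n v2 by (simp add: field_simps power2_eq_square)
    also have "\<dots> \<le> (real n * \<epsilon>)\<^sup>2 / (2 * (real B * C\<^sup>2))"
    proof (rule divide_left_mono)
      show "2 * (real B * C\<^sup>2) \<le> 2 * (real n * v2)" using BC by simp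
      show "0 < 2 * (real n * v2) * (2 * (real B * C\<^sup>2))"
        by (rule mult_pos_pos) (use pos n v2 in simp_all)
    qed simp
    finally show "exp (- ((real n * \<epsilon>)\<^sup>2 / (2 * real B * C\<^sup>2))) \<le> exp (- (real n * \<epsilon>\<^sup>2) / (2 * v2))"
      by (simp add: mult.assoc)
  qed auto
  finally show ?thesis by simp
qed

end
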